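(* Let $Q$ be a quiver arising from a triangulation of a marked bordered surface without punctures. For a vertex $k$ of $Q$, the following conditions are equivalent: (i) $k$ has in-degree $1$ and out-degree $1$. (ii) The quivers $Q$ and $\mu_k(Q)$ do not have the same number of arrows.
   Context: A quiver is a finite directed graph in which multiple arrows are allowed; quivers have no loops and no $2$-cycles. The in-degree (out-degree) of a vertex is the number of arrows ending (starting) at it. The mutation $\mu_k(Q)$ of $Q$ at a vertex $k$ is obtained by: (1) for every pair of arrows $i\to k$, $k\to j$ adding a new arrow $i\to j$; (2) reversing all arrows starting or ending at $k$; (3) removing a maximal set of $2$-cycles. A marked bordered surface without punctures $(S,M)$ consists of a compact connected oriented surface $S$ with non-empty boundary and a finite set $M\subset\partial S$ containing at least one point of each boundary component. The marked points cut the boundary into boundary segments. An arc is a curve in $S$, up to isotopy relative to $M$, with endpoints in $M$, without self-intersections except that its endpoints may coincide, whose interior is disjoint from $\partial S$, and which is neither contractible to a point of $M$ nor isotopic to a boundary segment. A triangulation is a collection of distinct arcs, having representatives with pairwise disjoint interiors, which cuts $S$ into triangles (sides are arcs or boundary segments). The quiver $Q$ of a triangulation has the arcs as vertices, and for each triangle and each pair of its sides $i,j$ that are arcs with $j$ following $i$ in the clockwise order of the triangle, an arrow $i\to j$; then a maximal set of $2$-cycles is removed. *)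

theory Defs
  imports "HOL-Complex_Analysis.Complex_Analysis" "HOL-Library.Multiset"
begin

section \<open>Quivers and mutation\<close>

text \<open>
  The arrows form a multiset of pairs (source, target), so that an arrow may occur several times.
\<close>

record 'v quiver =
  verts :: "'v set"
  arrows :: "('v \<times> 'v) multiset"

definition in_degree :: "'v quiver \<Rightarrow> 'v \<Rightarrow> nat" where
  "in_degree Q k = size {#e \<in># arrows Q. snd e = k#}"

definition out_degree :: "'v quiver \<Rightarrow> 'v \<Rightarrow> nat" where
  "out_degree Q k = size {#e \<in># arrows Q. fst e = k#}"

definition num_arrows :: "'v quiver \<Rightarrow> nat" where
  "num_arrows Q = size (arrows Q)"

text \<open>
  Removal of a maximal set of 2-cycles: for \<open>i \<noteq> j\<close>, the subtraction of multisets leaves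
  \<open>p - min p q\<close> of the \<open>p\<close> arrows from \<open>i\<close> to \<open>j\<close>, where \<open>q\<close> is the
  number of arrows from \<open>j\<close> to \<open>i\<close>. Loops are left alone.
\<close>

definition cancel_2cycles :: "('v \<times> 'v) multiset \<Rightarrow> ('v \<times> 'v) multiset" where
  "cancel_2cycles E = E - image_mset prod.swap {#e \<in># E. fst e \<noteq> snd e#}"

definition composite_arrows :: "'v \<Rightarrow> ('v \<times> 'v) multiset \<Rightarrow> ('v \<times> 'v) multiset" where
  "composite_arrows k E =
     (\<Sum>e \<in># {#e \<in># E. snd e = k#}. {#(fst e, snd e'). e' \<in># {#e' \<in># E. fst e' = k#}#})"

definition reverse_at :: "'v \<Rightarrow> ('v \<times> 'v) multiset \<Rightarrow> ('v \<times> 'v) multiset" where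
  "reverse_at k E = image_mset (\<lambda>e. if fst e = k \<or> snd e = k then prod.swap e else e) E"

definition mutation :: "'v \<Rightarrow> 'v quiver \<Rightarrow> 'v quiver" where
  "mutation k Q =
     \<lparr>verts = verts Q,
      arrows = cancel_2cycles (reverse_at k (arrows Q + composite_arrows k (arrows Q)))\<rparr>"


section \<open>Oriented surfaces with boundary\<close>

definition half_plane :: "complex set" where
  "half_plane = {z. 0 \<le> Im z}"

definition chart :: "'a topology \<Rightarrow> 'a set \<Rightarrow> ('a \<Rightarrow> complex) \<Rightarrow> bool" where
  "chart X U \<phi> \<longleftrightarrow>
     openin X U \<and>
     (\<exists>V. openin (top_of_set half_plane) V \<and>
          homeomorphic_map (subtopology X U) (top_of_set V) \<phi>)"

definition surface :: "'a topology \<Rightarrow> bool" where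
  "surface X \<longleftrightarrow>
     Hausdorff_space X \<and> second_countable X \<and>
     (\<forall>x \<in> topspace X. \<exists>U \<phi>. chart X U \<phi> \<and> x \<in> U)"

definition boundary :: "'a topology \<Rightarrow> 'a set" where
  "boundary X = {x. \<exists>U \<phi>. chart X U \<phi> \<and> x \<in> U \<and> Im (\<phi> x) = 0}"

text \<open>
  For \<open>h\<close> continuous and injective on \<open>W\<close>: \<open>h\<close> has local degree \<open>1\<close> at every
  interior point of \<open>W\<close>. No differentiability is involved.
\<close>

definition preserves_orientation :: "complex set \<Rightarrow> (complex \<Rightarrow> complex) \<Rightarrow> bool" where
  "preserves_orientation W h \<longleftrightarrow>
     (\<forall>z r. 0 < r \<and> cball z r \<subseteq> W \<longrightarrow> winding_number (h \<circ> circlepath z r) (h z) = 1)"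

text \<open>An orientation of a surface is given by an atlas with orientation preserving transition maps.\<close>

definition oriented_atlas :: "'a topology \<Rightarrow> ('a set \<times> ('a \<Rightarrow> complex)) set \<Rightarrow> bool" where
  "oriented_atlas X A \<longleftrightarrow>
     (\<forall>(U, \<phi>) \<in> A. chart X U \<phi>) \<and>
     topspace X = (\<Union>(U, \<phi>) \<in> A. U) \<and>
     (\<forall>(U, \<phi>) \<in> A. \<forall>(V, \<psi>) \<in> A.
        preserves_orientation (\<phi> ` (U \<inter> V)) (\<psi> \<circ> inv_into U \<phi>))"

definition marked_bordered_surface ::
  "'a topology \<Rightarrow> ('a set \<times> ('a \<Rightarrow> complex)) set \<Rightarrow> 'a set \<Rightarrow> bool" where
  "marked_bordered_surface X A M \<longleftrightarrow>
     surface X \<and> compact_space X \<and> connected_space X \<and> oriented_atlas X A \<and>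
     boundary X \<noteq> {} \<and> finite M \<and> M \<subseteq> boundary X \<and>
     (\<forall>C \<in> connected_components_of (subtopology X (boundary X)). C \<inter> M \<noteq> {})"


section \<open>Arcs and triangulations\<close>

definition curve_interior :: "(real \<Rightarrow> 'a) \<Rightarrow> 'a set" where
  "curve_interior \<gamma> = \<gamma> ` {0<..<1}"

definition simple_curve :: "'a topology \<Rightarrow> 'a set \<Rightarrow> (real \<Rightarrow> 'a) \<Rightarrow> bool" where
  "simple_curve X M \<gamma> \<longleftrightarrow>
     pathin X \<gamma> \<and> \<gamma> 0 \<in> M \<and> \<gamma> 1 \<in> M \<and>
     inj_on \<gamma> {0<..<1} \<and> curve_interior \<gamma> \<inter> M = {}"

text \<open>
  Isotopy relative to \<open>M\<close>: the endpoints stay fixed and all intermediate curves are simple with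
  interior disjoint from \<open>M\<close>. Intermediate curves may touch the boundary away from \<open>M\<close>, so
  that it makes sense for an arc to be isotopic to a boundary segment. Curves are not oriented.
\<close>

definition isotopic :: "'a topology \<Rightarrow> 'a set \<Rightarrow> (real \<Rightarrow> 'a) \<Rightarrow> (real \<Rightarrow> 'a) \<Rightarrow> bool" where
  "isotopic X M \<gamma> \<delta> \<longleftrightarrow>
     (\<exists>\<delta>' \<in> {\<delta>, \<lambda>t. \<delta> (1 - t)}.
        homotopic_with (\<lambda>c. simple_curve X M c \<and> c 0 = \<gamma> 0 \<and> c 1 = \<gamma> 1)
          (top_of_set {0..1}) X \<gamma> \<delta>')"

definition contractible_loop :: "'a topology \<Rightarrow> (real \<Rightarrow> 'a) \<Rightarrow> bool" where
  "contractible_loop X \<gamma> \<longleftrightarrow>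
     homotopic_with (\<lambda>c. c 0 = \<gamma> 0 \<and> c 1 = \<gamma> 0) (top_of_set {0..1}) X \<gamma> (\<lambda>_. \<gamma> 0)"

definition open_boundary_segments :: "'a topology \<Rightarrow> 'a set \<Rightarrow> 'a set set" where
  "open_boundary_segments X M = connected_components_of (subtopology X (boundary X - M))"

definition boundary_segment :: "'a topology \<Rightarrow> 'a set \<Rightarrow> (real \<Rightarrow> 'a) \<Rightarrow> bool" where
  "boundary_segment X M \<delta> \<longleftrightarrow>
     simple_curve X M \<delta> \<and> curve_interior \<delta> \<in> open_boundary_segments X M"

definition arc_curve :: "'a topology \<Rightarrow> 'a set \<Rightarrow> (real \<Rightarrow> 'a) \<Rightarrow> bool" where
  "arc_curve X M \<gamma> \<longleftrightarrow>
     simple_curve X M \<gamma> \<and> curve_interior \<gamma> \<inter> boundary X = {} \<and>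
     \<not> contractible_loop X \<gamma> \<and>
     \<not> (\<exists>\<delta>. boundary_segment X M \<delta> \<and> isotopic X M \<gamma> \<delta>)"

text \<open>The arcs of the marked surface are isotopy classes.\<close>

definition arcs :: "'a topology \<Rightarrow> 'a set \<Rightarrow> (real \<Rightarrow> 'a) set set" where
  "arcs X M = (\<lambda>\<gamma>. {\<delta>. arc_curve X M \<delta> \<and> isotopic X M \<gamma> \<delta>}) ` {\<gamma>. arc_curve X M \<gamma>}"

text \<open>
  The model triangle has the third roots of unity as corners. They are numbered clockwise, modulo
  \<open>3\<close>, so that \<open>model_side (n + 1)\<close> follows \<open>model_side n\<close> in clockwise order.
\<close>

definition model_corner :: "nat \<Rightarrow> complex" where
  "model_corner n = cis (- 2 * pi * real n / 3)"

definition model_side :: "nat \<Rightarrow> complex set" where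
  "model_side n = open_segment (model_corner n) (model_corner (n + 1))"

definition model_triangle :: "complex set" where
  "model_triangle = convex hull (model_corner ` {0, 1, 2})"

text \<open>
  Below, \<open>T\<close> is a set of arcs and \<open>rep a\<close> is a curve representing \<open>a \<in> T\<close>.
\<close>

definition regions ::
  "'a topology \<Rightarrow> (real \<Rightarrow> 'a) set set \<Rightarrow> ((real \<Rightarrow> 'a) set \<Rightarrow> real \<Rightarrow> 'a) \<Rightarrow> 'a set set" where
  "regions X T rep =
     connected_components_of
       (subtopology X (topspace X - boundary X - (\<Union>a \<in> T. curve_interior (rep a))))"

text \<open>
  \<open>f\<close> exhibits the piece with interior \<open>U\<close>, obtained by cutting the surface along the
  representatives, as a triangle. Corners and sides of the triangle may become identified
  in the surface, so \<open>f\<close> need not be injective on the closed triangle.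
\<close>

definition triangle_map ::
  "'a topology \<Rightarrow> 'a set \<Rightarrow> (real \<Rightarrow> 'a) set set \<Rightarrow> ((real \<Rightarrow> 'a) set \<Rightarrow> real \<Rightarrow> 'a) \<Rightarrow>
   'a set \<Rightarrow> (complex \<Rightarrow> 'a) \<Rightarrow> bool" where
  "triangle_map X M T rep U f \<longleftrightarrow>
     continuous_map (top_of_set model_triangle) X f \<and>
     homeomorphic_map (top_of_set (interior model_triangle)) (subtopology X U) f \<and>
     (\<forall>n \<in> {0, 1, 2}.
        f (model_corner n) \<in> M \<and>
        inj_on f (model_side n) \<and>
        f ` model_side n \<in> (\<lambda>a. curve_interior (rep a)) ` T \<union> open_boundary_segments X M)"

definition cuts_into_triangles ::
  "'a topology \<Rightarrow> 'a set \<Rightarrow> (real \<Rightarrow> 'a) set set \<Rightarrow> ((real \<Rightarrow> 'a) set \<Rightarrow> real \<Rightarrow> 'a) \<Rightarrow> bool" where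
  "cuts_into_triangles X M T rep \<longleftrightarrow> (\<forall>U \<in> regions X T rep. \<exists>f. triangle_map X M T rep U f)"

definition triangulation_with_reps ::
  "'a topology \<Rightarrow> 'a set \<Rightarrow> (real \<Rightarrow> 'a) set set \<Rightarrow> ((real \<Rightarrow> 'a) set \<Rightarrow> real \<Rightarrow> 'a) \<Rightarrow> bool" where
  "triangulation_with_reps X M T rep \<longleftrightarrow>
     finite T \<and> T \<subseteq> arcs X M \<and> (\<forall>a \<in> T. rep a \<in> a) \<and>
     (\<forall>a \<in> T. \<forall>b \<in> T. a \<noteq> b \<longrightarrow> curve_interior (rep a) \<inter> curve_interior (rep b) = {}) \<and>
     cuts_into_triangles X M T rep"


section \<open>The quiver of a triangulation\<close>

definition orientation_preserving_triangle ::
  "('a set \<times> ('a \<Rightarrow> complex)) set \<Rightarrow> (complex \<Rightarrow> 'a) \<Rightarrow> bool" where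
  "orientation_preserving_triangle A f \<longleftrightarrow>
     (\<forall>(V, \<phi>) \<in> A. preserves_orientation {z \<in> interior model_triangle. f z \<in> V} (\<phi> \<circ> f))"

text \<open>
  For the triangles parametrised by \<open>tri U\<close>: one arrow from \<open>a\<close> to \<open>b\<close> for each
  triangle \<open>U\<close> and each side \<open>n\<close> of it such that the sides \<open>n\<close> and \<open>n + 1\<close>
  are the arcs \<open>a\<close> and \<open>b\<close>.
\<close>

definition triangle_arrows ::
  "'a topology \<Rightarrow> (real \<Rightarrow> 'a) set set \<Rightarrow> ((real \<Rightarrow> 'a) set \<Rightarrow> real \<Rightarrow> 'a) \<Rightarrow>
   ('a set \<Rightarrow> complex \<Rightarrow> 'a) \<Rightarrow> ((real \<Rightarrow> 'a) set \<times> (real \<Rightarrow> 'a) set) multiset" where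
  "triangle_arrows X T rep tri =
     image_mset (\<lambda>(U, n, a, b). (a, b))
       (mset_set {(U, n, a, b).
          U \<in> regions X T rep \<and> n \<in> {0, 1, 2} \<and> a \<in> T \<and> b \<in> T \<and>
          tri U ` model_side n = curve_interior (rep a) \<and>
          tri U ` model_side (n + 1) = curve_interior (rep b)})"

definition quiver_of_triangulation ::
  "'a topology \<Rightarrow> ('a set \<times> ('a \<Rightarrow> complex)) set \<Rightarrow> 'a set \<Rightarrow> (real \<Rightarrow> 'a) set set \<Rightarrow>
   (real \<Rightarrow> 'a) set quiver \<Rightarrow> bool" where
  "quiver_of_triangulation X A M T Q \<longleftrightarrow>
     (\<exists>rep tri.
        triangulation_with_reps X M T rep \<and>
        (\<forall>U \<in> regions X T rep.
           triangle_map X M T rep U (tri U) \<and> orientation_preserving_triangle A (tri U)) \<and>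
        Q = \<lparr>verts = T, arrows = cancel_2cycles (triangle_arrows X T rep tri)\<rparr>)"

end

theory Submission
  imports Defs
begin

text \<open>
  If there are no 2-cycles and no loops at \<open>k\<close>, mutation at \<open>k\<close> creates \<open>in \<cdot> out\<close> arrows
  (\<open>in\<close>, \<open>out\<close> being the degrees of \<open>k\<close>) and each cancellation removes two arrows. So the number
  of arrows changes by an odd number if both degrees are 1, and it does not change if one of them
  is 0. In the remaining cases \<open>k\<close> is a side of two different triangles. Each of the two gives at
  most one arrow opposite to \<open>k\<close>, and exactly these are cancelled, so that half as many arrows are
  cancelled as are created. Any deviation from this count would be caused by two or three triangles
  that close up around a common vertex.

  Such a vertex cannot exist: the corners of the triangles glue to a continuous injection of a
  planar disc, which by invariance of domain misses the boundary, whereas the marked points lie on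
  it. In the same way, an arc cannot lie on three sides, since two of them already glue to an open
  neighbourhood. The corners fit together because the identification of two sides reverses their
  direction; otherwise the glued map would have local degree \<open>-1\<close> on one side of the arc and \<open>1\<close> on
  the other.
\<close>

section \<open>Counting arrows under mutation\<close>

text \<open>The definition of the quiver does not rule out a triangle with the same arc on two
  sides, while the orientation argument compares only triangles with disjoint interiors. Such a
  triangle is therefore handled by counting. If two sides of one triangle carry \<open>k\<close>,
  then \<open>k\<close> keeps exactly one arrow, a loop: an arc on the third side would give a
  2-cycle with \<open>k\<close>, which cancels. Mutation at such a \<open>k\<close> adds one loop,
  in agreement with (ii).

  The degrees in (i) are those after cancellation, whereas the triangles describe the arrows before
  it. An arc lies on at most two sides, so both degrees are at most 2 before cancellation. If a
  2-cycle through \<open>k\<close> were cancelled, both would be at most 1 afterwards. Hence, as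
  soon as the degrees add up to 3 or more, nothing has been cancelled at \<open>k\<close> and its
  arrows can be read off from its two triangles.\<close>

lemma count_image_swap: "count (image_mset prod.swap E) (x, y) = count E (y, x)"
proof (induction E)
  case (add e E)
  obtain a b where "e = (a, b)" by fastforce
  with add show ?case by simp
qed simp

lemma count_cancel_2cycles:
  "count (cancel_2cycles E) (x, y) = count E (x, y) - (if x = y then 0 else count E (y, x))"
  by (simp add: cancel_2cycles_def count_image_swap)

definition no_2cycles :: "('v \<times> 'v) multiset \<Rightarrow> bool" where
  "no_2cycles E \<longleftrightarrow> (\<forall>x y. x \<noteq> y \<longrightarrow> (x, y) \<in># E \<longrightarrow> (y, x) \<notin># E)"

lemma no_2cycles_cancel_2cycles: "no_2cycles (cancel_2cycles E)"
  unfolding no_2cycles_def count_greater_zero_iff[symmetric] count_cancel_2cycles by auto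

text \<open>A 2-cycle of \<open>A + B\<close> has one arrow in \<open>A\<close> and one in
  \<open>B\<close>. The cancelled arrows of \<open>A\<close> and those of \<open>B\<close> are
  exchanged by \<open>prod.swap\<close>, so they are equally many, whence the factor 2. A loop of
  \<open>B\<close> would be its own swap and could be counted in the intersection although loops are
  never cancelled.\<close>

lemma size_cancel_2cycles_union:
  assumes A: "no_2cycles A" and B: "no_2cycles B" and loops: "\<forall>x. (x, x) \<notin># B"
  shows "size (cancel_2cycles (A + B)) + 2 * size (A \<inter># image_mset prod.swap B) = size A + size B"
proof -
  have eq: "cancel_2cycles (A + B) + (A \<inter># image_mset prod.swap B) + (B \<inter># image_mset prod.swap A) = A + B"
  proof (rule multiset_eqI)
    fix e :: "'a \<times> 'a"
    obtain x y where e: "e = (x, y)" by fastforce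
    have a: "x \<noteq> y \<Longrightarrow> count A (x, y) = 0 \<or> count A (y, x) = 0"
      using A unfolding no_2cycles_def by (metis count_eq_zero_iff)
    have b: "x \<noteq> y \<Longrightarrow> count B (x, y) = 0 \<or> count B (y, x) = 0"
      using B unfolding no_2cycles_def by (metis count_eq_zero_iff)
    have c: "x = y \<Longrightarrow> count B (x, y) = 0"
      using loops by (metis count_eq_zero_iff)
    show "count (cancel_2cycles (A + B) + (A \<inter># image_mset prod.swap B) + (B \<inter># image_mset prod.swap A)) e = count (A + B) e"
      unfolding e by (cases "x = y") (use a b c in \<open>auto simp: count_cancel_2cycles count_image_swap min_def\<close>)
  qed
  have "B \<inter># image_mset prod.swap A = image_mset prod.swap (A \<inter># image_mset prod.swap B)"
    by (rule multiset_eqI) (auto simp: count_image_swap min.commute)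
  then have "size (B \<inter># image_mset prod.swap A) = size (A \<inter># image_mset prod.swap B)"
    by simp
  with arg_cong[OF eq, of size] show ?thesis by simp
qed

lemma reverse_at_add: "reverse_at k (A + B) = reverse_at k A + reverse_at k B"
  by (simp add: reverse_at_def)

lemma reverse_at_id:
  assumes "\<And>e. e \<in># A \<Longrightarrow> fst e \<noteq> k \<and> snd e \<noteq> k"
  shows "reverse_at k A = A"
proof -
  have "reverse_at k A = image_mset (\<lambda>e. e) A"
    unfolding reverse_at_def by (rule image_mset_cong) (simp add: assms)
  then show ?thesis by simp
qed

lemma count_reverse_at:
  "count (reverse_at k E) (x, y) = (if x = k \<or> y = k then count E (y, x) else count E (x, y))"
proof (induction E)
  case (add e E)
  obtain a b where "e = (a, b)" by fastforce
  with add show ?case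
    by (cases "a = k"; cases "b = k"; cases "x = k"; cases "y = k"; auto simp: reverse_at_def)
qed (simp add: reverse_at_def)

lemma size_reverse_at [simp]: "size (reverse_at k E) = size E"
  by (simp add: reverse_at_def)

lemma in_reverse_at:
  "(x, y) \<in># reverse_at k E \<longleftrightarrow> (if x = k \<or> y = k then (y, x) \<in># E else (x, y) \<in># E)"
  unfolding count_greater_zero_iff[symmetric] count_reverse_at by simp

lemma no_2cycles_reverse_at: "no_2cycles E \<Longrightarrow> no_2cycles (reverse_at k E)"
  unfolding no_2cycles_def in_reverse_at by metis

lemma in_composite_arrows: "(x, y) \<in># composite_arrows k E \<longleftrightarrow> (x, k) \<in># E \<and> (k, y) \<in># E"
  by (force simp: composite_arrows_def)

lemma size_composite_arrows:
  "size (composite_arrows k (arrows Q)) = in_degree Q k * out_degree Q k"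
proof -
  have "size (\<Sum>e\<in>#A. {#(fst e, snd e'). e' \<in># B#}) = size A * size B" for A B :: "('a \<times> 'a) multiset"
    by (induction A) auto
  then show ?thesis by (simp add: composite_arrows_def in_degree_def out_degree_def)
qed

text \<open>Composite arrows avoid \<open>k\<close>, so the reversal does not affect them, and the
  arrows that it does affect cannot cancel against composites. Two opposite composites, or a
  composite loop, would need a 2-cycle through \<open>k\<close>. Only old arrows against composites
  remain to be cancelled.\<close>

lemma num_arrows_mutation:
  assumes Q: "no_2cycles (arrows Q)" and k: "(k, k) \<notin># arrows Q"
  shows "num_arrows (mutation k Q) + 2 * size (arrows Q \<inter># image_mset prod.swap (composite_arrows k (arrows Q)))
     = num_arrows Q + in_degree Q k * out_degree Q k"
proof -
  let ?E = "arrows Q" and ?C = "composite_arrows k (arrows Q)"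
  have C: "no_2cycles ?C" "\<forall>x. (x, x) \<notin># ?C"
    using Q k unfolding no_2cycles_def in_composite_arrows by metis+
  have C': "reverse_at k ?C = ?C"
  proof (rule reverse_at_id)
    fix e assume "e \<in># ?C"
    with k in_composite_arrows[of "fst e" "snd e" k ?E] show "fst e \<noteq> k \<and> snd e \<noteq> k" by auto
  qed
  have "reverse_at k ?E \<inter># image_mset prod.swap ?C = ?E \<inter># image_mset prod.swap ?C"
  proof (rule multiset_eqI)
    fix e :: "'a \<times> 'a"
    obtain x y where e: "e = (x, y)" by fastforce
    have "x = k \<or> y = k \<Longrightarrow> count ?C (y, x) = 0"
      using k in_composite_arrows[of y x k ?E] by (auto simp: count_eq_zero_iff)
    then show "count (reverse_at k ?E \<inter># image_mset prod.swap ?C) e = count (?E \<inter># image_mset prod.swap ?C) e"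
      unfolding e by (auto simp: count_reverse_at count_image_swap)
  qed
  with size_cancel_2cycles_union[OF no_2cycles_reverse_at[OF Q, of k] C] show ?thesis
    by (simp add: mutation_def num_arrows_def reverse_at_add C' size_composite_arrows)
qed

text \<open>The loop is the only arrow at \<open>k\<close>, so its composite with itself is one more
  loop at \<open>k\<close>. Cancellation leaves loops alone, so the count rises by one.\<close>

lemma num_arrows_mutation_loop:
  assumes Q: "no_2cycles (arrows Q)" and k: "(k, k) \<in># arrows Q"
    and "in_degree Q k = 1" "out_degree Q k = 1"
  shows "num_arrows (mutation k Q) = num_arrows Q + 1"
proof -
  let ?E = "arrows Q"
  have 1: "{#e \<in># ?E. snd e = k#} = {#(k, k)#}" "{#e \<in># ?E. fst e = k#} = {#(k, k)#}"
    using assms unfolding in_degree_def out_degree_def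
    by (metis (mono_tags, lifting) One_nat_def count_filter_mset count_greater_zero_iff fst_conv snd_conv size_1_singleton_mset set_mset_add_mset_insert insertE empty_iff set_mset_empty)+
  have C: "composite_arrows k ?E = {#(k, k)#}"
    by (simp add: composite_arrows_def 1)
  have R: "no_2cycles (reverse_at k (?E + {#(k, k)#}))"
    by (rule no_2cycles_reverse_at) (use Q in \<open>auto simp: no_2cycles_def\<close>)
  have "cancel_2cycles E = E" if "no_2cycles E" for E :: "('a \<times> 'a) multiset"
  proof (rule multiset_eqI)
    fix e :: "'a \<times> 'a"
    obtain x y where e: "e = (x, y)" by fastforce
    show "count (cancel_2cycles E) e = count E e"
      using that unfolding e no_2cycles_def by (auto simp: count_cancel_2cycles) (metis count_eq_zero_iff diff_zero not_in_iff diff_0_eq_0)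
  qed
  from this[OF R] show ?thesis
    by (simp add: mutation_def num_arrows_def C)
qed

lemma num_arrows_mutation_neq:
  assumes Q: "no_2cycles (arrows Q)" and 1: "in_degree Q k = 1" "out_degree Q k = 1"
  shows "num_arrows Q \<noteq> num_arrows (mutation k Q)"
proof (cases "(k, k) \<in># arrows Q")
  case True
  with num_arrows_mutation_loop[OF Q _ 1] show ?thesis by simp
next
  case False
  have "n + 2 * s = n + 1 \<Longrightarrow> False" for n s :: nat by presburger
  with num_arrows_mutation[OF Q False] 1 show ?thesis by (metis mult.right_neutral)
qed

section \<open>Labelled triangles\<close>

lemma count_composite_arrows:
  "count (composite_arrows k E) (x, y) = count E (x, k) * count E (k, y)"
proof -
  have 1: "count {#(a, snd e'). e' \<in># {#e' \<in># E. fst e' = k#}#} (x, y) = (if a = x then count E (k, y) else 0)" for a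
  proof (induction E)
    case (add e E)
    obtain b c where "e = (b, c)" by fastforce
    with add show ?case by (cases "b = k"; cases "c = y"; cases "a = x"; simp)
  qed simp
  have "count (\<Sum>e \<in># {#e \<in># F. snd e = k#}. {#(fst e, snd e'). e' \<in># {#e' \<in># E. fst e' = k#}#}) (x, y)
    = count F (x, k) * count E (k, y)" for F
  proof (induction F)
    case (add e E)
    obtain b c where "e = (b, c)" by fastforce
    with add show ?case by (cases "b = x"; cases "c = k"; simp add: 1)
  qed simp
  then show ?thesis by (simp add: composite_arrows_def)
qed

lemma count_out: "count (image_mset snd {#e \<in># E. fst e = k#}) y = count E (k, y)"
proof (induction E)
  case (add e E)
  obtain b c where "e = (b, c)" by fastforce
  with add show ?case by (cases "b = k"; cases "c = y"; simp)
qed simp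

lemma count_in: "count (image_mset fst {#e \<in># E. snd e = k#}) x = count E (x, k)"
proof (induction E)
  case (add e E)
  obtain b c where "e = (b, c)" by fastforce
  with add show ?case by (cases "b = x"; cases "c = k"; simp)
qed simp

lemma less_3_iff: "n \<in> {0, 1, 2} \<longleftrightarrow> n < (3 :: nat)"
  by auto

definition mset_option :: "'a option \<Rightarrow> 'a multiset" where
  "mset_option z = (case z of None \<Rightarrow> {#} | Some a \<Rightarrow> {#a#})"

lemma count_mset_option [simp]: "count (mset_option z) a = of_bool (z = Some a)"
  by (cases z) (auto simp: mset_option_def)

lemma size_mset_option [simp]: "size (mset_option z) = of_bool (z \<noteq> None)"
  by (cases z) (auto simp: mset_option_def)

text \<open>A triangle at \<open>k\<close> yields an arrow opposite to \<open>k\<close> exactly when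
  both of its other sides are arcs; one boundary segment, coded as \<open>None\<close>, makes the
  pair disappear.\<close>

definition pair_option :: "'a option \<Rightarrow> 'b option \<Rightarrow> ('a \<times> 'b) option" where
  "pair_option z w = (case z of None \<Rightarrow> None | Some a \<Rightarrow> map_option (Pair a) w)"

lemma pair_option_eq_Some [simp]: "pair_option z w = Some (a, b) \<longleftrightarrow> z = Some a \<and> w = Some b"
  by (auto simp: pair_option_def split: option.splits)

lemma pair_option_eq_None [simp]: "pair_option z w = None \<longleftrightarrow> z = None \<or> w = None"
  by (auto simp: pair_option_def split: option.splits)

text \<open>\<open>triangle_arrows\<close> with the geometry forgotten: only the labels of the sides
  remain. The index set still consists of quadruples, and \<open>mset_set\<close> still gives the
  empty multiset if it is infinite.\<close>

definition corner_arrows :: "('u \<Rightarrow> nat \<Rightarrow> 'a option) \<Rightarrow> ('a \<times> 'a) multiset" where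
  "corner_arrows L = image_mset (\<lambda>(U, n, a, b). (a, b))
     (mset_set {(U, n, a, b). n \<in> {0, 1, 2} \<and> L U n = Some a \<and> L U (n + 1) = Some b})"

text \<open>\<open>L U n\<close> is the arc on side \<open>n\<close> of the triangle \<open>U\<close>, or \<open>None\<close> for a boundary
  segment. A corner cycle would close up around an interior vertex, i.e. a puncture.\<close>

locale triangle_labelling =
  fixes L :: "'u \<Rightarrow> nat \<Rightarrow> 'a option"
  assumes periodic [simp]: "L U (n + 3) = L U n"
    and two_sides: "\<lbrakk>L U n = Some a; L V m = Some a; L W l = Some a; n < 3; m < 3; l < 3\<rbrakk>
      \<Longrightarrow> (U, n) = (V, m) \<or> (U, n) = (W, l) \<or> (V, m) = (W, l)"
    and no_corner_2cycle: "\<lbrakk>U \<noteq> V; a \<noteq> b; L U n = Some a; L U (n + 1) = Some b;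
      L V m = Some b; L V (m + 1) = Some a\<rbrakk> \<Longrightarrow> False"
    and no_corner_3cycle: "\<lbrakk>distinct [U, V, W]; distinct [a, b, c];
      L U n = Some a; L U (n + 1) = Some b; L V m = Some b; L V (m + 1) = Some c;
      L W l = Some c; L W (l + 1) = Some a\<rbrakk> \<Longrightarrow> False"
    and finite_corners: "finite {(U, n, a, b). n \<in> {0, 1, 2} \<and> L U n = Some a \<and> L U (n + 1) = Some b}"
begin

lemma periodic' [simp]: "L U (Suc (Suc (Suc n))) = L U n"
  using periodic[of U n] by (simp add: eval_nat_numeral)

lemma count_corner_arrows:
  "count (corner_arrows L) (x, y) = card {(U, n). n < 3 \<and> L U n = Some x \<and> L U (n + 1) = Some y}"
proof -
  let ?S = "{(U, n, a, b). n \<in> {0, 1, 2} \<and> L U n = Some a \<and> L U (n + 1) = Some b}"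
  have "count (corner_arrows L) (x, y) = card {s \<in> ?S. (\<lambda>(U, n, a, b). (a, b)) s = (x, y)}"
    using finite_corners by (simp add: corner_arrows_def count_image_mset Int_def vimage_def conj_commute)
  also have "{s \<in> ?S. (\<lambda>(U, n, a, b). (a, b)) s = (x, y)}
      = (\<lambda>(U, n). (U, n, x, y)) ` {(U, n). n < 3 \<and> L U n = Some x \<and> L U (n + 1) = Some y}"
    unfolding less_3_iff by auto
  also have "card \<dots> = card {(U, n). n < 3 \<and> L U n = Some x \<and> L U (n + 1) = Some y}"
    by (rule card_image) (auto simp: inj_on_def)
  finally show ?thesis .
qed

text \<open>A corner is indexed here by its second side instead of its first, which is a rotation of
  the indices modulo 3. In this form the arrows into \<open>k\<close> are sorted by the sides that
  carry \<open>k\<close>.\<close>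

lemma count_corner_arrows':
  "count (corner_arrows L) (x, y) = card {(U, n). n < 3 \<and> L U (n + 2) = Some x \<and> L U n = Some y}"
proof -
  have "bij_betw (\<lambda>(U, n). (U, if n = 2 then 0 else n + 1))
     {(U, n). n < 3 \<and> L U n = Some x \<and> L U (n + 1) = Some y} {(U, n). n < 3 \<and> L U (n + 2) = Some x \<and> L U n = Some y}"
    by (rule bij_betw_byWitness[where f' = "\<lambda>(U, n). (U, if n = 0 then 2 else n - 1)"])
      (auto split: if_splits simp: eval_nat_numeral less_Suc_eq)
  then show ?thesis
    by (simp add: count_corner_arrows bij_betw_same_card)
qed

lemma finite_corner: "finite {(U, n). n < 3 \<and> L U n = Some x \<and> L U (n + 1) = Some y}"
proof -
  have "(\<lambda>(U, n). (U, n, x, y)) ` {(U, n). n < 3 \<and> L U n = Some x \<and> L U (n + 1) = Some y}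
    \<subseteq> {(U, n, a, b). n \<in> {0, 1, 2} \<and> L U n = Some a \<and> L U (n + 1) = Some b}"
    unfolding less_3_iff by auto
  then have "finite ((\<lambda>(U, n). (U, n, x, y)) ` {(U, n). n < 3 \<and> L U n = Some x \<and> L U (n + 1) = Some y})"
    using finite_corners finite_subset by blast
  then show ?thesis by (rule finite_imageD) (auto simp: inj_on_def)
qed

abbreviation outs where "outs E k \<equiv> image_mset snd {#e \<in># E. fst e = k#}"
abbreviation ins where "ins E k \<equiv> image_mset fst {#e \<in># E. snd e = k#}"

lemma (in -) card_Collect_pair:
  "s \<noteq> t \<Longrightarrow> card {x. (x = s \<or> x = t) \<and> P x} = of_bool (P s) + of_bool (P t)"
proof -
  assume "s \<noteq> t"
  moreover have "{x. (x = s \<or> x = t) \<and> P x} = (if P s then {s} else {}) \<union> (if P t then {t} else {})" by auto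
  ultimately show ?thesis by (cases "P s"; cases "P t"; simp)
qed

text \<open>An arrow out of \<open>k\<close> comes from a corner whose first side carries
  \<open>k\<close>, and there are two such sides. A boundary segment after one of them contributes
  the empty multiset.\<close>

lemma outs_corner_arrows:
  assumes K: "\<And>W j. j < 3 \<and> L W j = Some k \<longleftrightarrow> (W, j) = (U, n) \<or> (W, j) = (V, m)"
    and "(U, n) \<noteq> (V, m)"
  shows "outs (corner_arrows L) k = mset_option (L U (n + 1)) + mset_option (L V (m + 1))"
proof (rule multiset_eqI)
  fix y
  let ?P = "\<lambda>(W, j). L W (j + 1) = Some y"
  have "{(W, j). j < 3 \<and> L W j = Some k \<and> L W (j + 1) = Some y}
      = {x. (x = (U, n) \<or> x = (V, m)) \<and> ?P x}"
  proof (rule set_eqI)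
    fix x :: "'u \<times> nat"
    obtain W j where x: "x = (W, j)" by fastforce
    show "x \<in> {(W, j). j < 3 \<and> L W j = Some k \<and> L W (j + 1) = Some y} \<longleftrightarrow>
        x \<in> {x. (x = (U, n) \<or> x = (V, m)) \<and> ?P x}"
      unfolding x mem_Collect_eq prod.case using K[of j W] by argo
  qed
  with card_Collect_pair[OF assms(2), of ?P]
  show "count (outs (corner_arrows L) k) y = count (mset_option (L U (n + 1)) + mset_option (L V (m + 1))) y"
    by (simp only: count_out count_corner_arrows prod.case count_union count_mset_option)
qed

text \<open>The predecessor of side \<open>n\<close> is written \<open>n + 2\<close>, which agrees
  with \<open>n - 1\<close> modulo 3 and avoids truncated subtraction.\<close>

lemma ins_corner_arrows:
  assumes K: "\<And>W j. j < 3 \<and> L W j = Some k \<longleftrightarrow> (W, j) = (U, n) \<or> (W, j) = (V, m)"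
    and "(U, n) \<noteq> (V, m)"
  shows "ins (corner_arrows L) k = mset_option (L U (n + 2)) + mset_option (L V (m + 2))"
proof (rule multiset_eqI)
  fix y
  let ?P = "\<lambda>(W, j). L W (j + 2) = Some y"
  have "{(W, j). j < 3 \<and> L W (j + 2) = Some y \<and> L W j = Some k}
      = {x. (x = (U, n) \<or> x = (V, m)) \<and> ?P x}"
  proof (rule set_eqI)
    fix x :: "'u \<times> nat"
    obtain W j where x: "x = (W, j)" by fastforce
    show "x \<in> {(W, j). j < 3 \<and> L W (j + 2) = Some y \<and> L W j = Some k} \<longleftrightarrow>
        x \<in> {x. (x = (U, n) \<or> x = (V, m)) \<and> ?P x}"
      unfolding x mem_Collect_eq prod.case using K[of j W] by argo
  qed
  with card_Collect_pair[OF assms(2), of ?P]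
  show "count (ins (corner_arrows L) k) y = count (mset_option (L U (n + 2)) + mset_option (L V (m + 2))) y"
    by (simp only: count_in count_corner_arrows' prod.case count_union count_mset_option)
qed

text \<open>\<open>K\<close> also admits an arc on no side at all. The bounds hold before
  cancellation already, so such an arc cannot have degrees adding up to 3.\<close>

lemma degrees_le_1:
  assumes K: "\<And>W j. j < 3 \<Longrightarrow> L W j = Some k \<Longrightarrow> (W, j) = (U, n)"
  shows "size (outs (corner_arrows L) k) \<le> 1" "size (ins (corner_arrows L) k) \<le> 1"
proof -
  have "count (outs (corner_arrows L) k) y \<le> count (mset_option (L U (n + 1))) y" for y
  proof -
    have "{(W, j). j < 3 \<and> L W j = Some k \<and> L W (j + 1) = Some y} \<subseteq> (if L U (n + 1) = Some y then {(U, n)} else {})"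
    proof
      fix s assume s: "s \<in> {(W, j). j < 3 \<and> L W j = Some k \<and> L W (j + 1) = Some y}"
      obtain W j where "s = (W, j)" by fastforce
      with s K[of j W] show "s \<in> (if L U (n + 1) = Some y then {(U, n)} else {})" by simp
    qed
    then have "card {(W, j). j < 3 \<and> L W j = Some k \<and> L W (j + 1) = Some y} \<le> card (if L U (n + 1) = Some y then {(U, n)} else {})" by (rule card_mono[rotated]) simp
    then show ?thesis unfolding count_out count_corner_arrows count_mset_option by (cases "L U (n + 1) = Some y") simp_all
  qed
  then have "outs (corner_arrows L) k \<subseteq># mset_option (L U (n + 1))" by (rule mset_subset_eqI)
  from size_mset_mono[OF this] show "size (outs (corner_arrows L) k) \<le> 1"
    by (rule order_trans) simp
  have "count (ins (corner_arrows L) k) y \<le> count (mset_option (L U (n + 2))) y" for y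
  proof -
    have "{(W, j). j < 3 \<and> L W (j + 2) = Some y \<and> L W j = Some k} \<subseteq> (if L U (n + 2) = Some y then {(U, n)} else {})"
    proof
      fix s assume s: "s \<in> {(W, j). j < 3 \<and> L W (j + 2) = Some y \<and> L W j = Some k}"
      obtain W j where "s = (W, j)" by fastforce
      with s K[of j W] show "s \<in> (if L U (n + 2) = Some y then {(U, n)} else {})" by simp
    qed
    then have "card {(W, j). j < 3 \<and> L W (j + 2) = Some y \<and> L W j = Some k} \<le> card (if L U (n + 2) = Some y then {(U, n)} else {})" by (rule card_mono[rotated]) simp
    then show ?thesis unfolding count_in count_corner_arrows' count_mset_option by (cases "L U (n + 2) = Some y") simp_all
  qed
  then have "ins (corner_arrows L) k \<subseteq># mset_option (L U (n + 2))" by (rule mset_subset_eqI)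
  from size_mset_mono[OF this] show "size (ins (corner_arrows L) k) \<le> 1"
    by (rule order_trans) simp
qed

lemma sides_cases:
  obtains U n where "\<And>W j. j < 3 \<Longrightarrow> L W j = Some k \<Longrightarrow> (W, j) = (U, n)"
  | U n V m where "(U, n) \<noteq> (V, m)" "\<And>W j. j < 3 \<and> L W j = Some k \<longleftrightarrow> (W, j) = (U, n) \<or> (W, j) = (V, m)"
proof (cases "\<exists>U n. \<forall>W j. j < 3 \<longrightarrow> L W j = Some k \<longrightarrow> (W, j) = (U, n)")
  case True
  then show ?thesis using that(1) by blast
next
  case False
  then obtain U n where 1: "n < 3" "L U n = Some k" by blast
  from False have "\<not> (\<forall>W j. j < 3 \<longrightarrow> L W j = Some k \<longrightarrow> (W, j) = (U, n))" by blast
  then obtain V m where 2: "m < 3" "L V m = Some k" "(V, m) \<noteq> (U, n)" by blast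
  show ?thesis
  proof (rule that(2))
    show "(U, n) \<noteq> (V, m)" using 2(3) by (rule not_sym)
    fix W j
    show "j < 3 \<and> L W j = Some k \<longleftrightarrow> (W, j) = (U, n) \<or> (W, j) = (V, m)"
    proof
      assume "j < 3 \<and> L W j = Some k"
      with two_sides[OF 1(2) 2(2) _ 1(1) 2(1), of W j] 2(3) show "(W, j) = (U, n) \<or> (W, j) = (V, m)" by auto
    qed (use 1 2 in auto)
  qed
qed

text \<open>Two sides of one triangle are adjacent, so \<open>k\<close> follows itself at a corner
  and gives a loop. An arc on the third side would both follow and precede \<open>k\<close>, which
  \<open>disj\<close> forbids. The third side is thus a boundary segment, and the loop alone does
  not give a degree of 2.\<close>

lemma distinct_triangles:
  assumes K: "\<And>W j. j < 3 \<and> L W j = Some k \<longleftrightarrow> (W, j) = (U, n) \<or> (W, j) = (V, m)"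
    and ne: "(U, n) \<noteq> (V, m)"
    and disj: "\<And>y. y \<noteq> k \<Longrightarrow> y \<in># outs (corner_arrows L) k \<Longrightarrow> y \<notin># ins (corner_arrows L) k"
    and "size (outs (corner_arrows L) k) \<ge> 2 \<or> size (ins (corner_arrows L) k) \<ge> 2"
  shows "U \<noteq> V"
proof
  assume "U = V"
  have "n < 3 \<and> L U n = Some k" "m < 3 \<and> L V m = Some k" by (rule K[THEN iffD2]; simp)+
  then have nm: "n < 3" "m < 3" "L U n = Some k" "L V m = Some k" by blast+
  \<comment> \<open>Stated for the side \<open>n\<close> that precedes the side \<open>m\<close> in
    clockwise order, wrap-around included; it is applied below in both roles of the two
    sides.\<close>
  have *: False if n: "n < 3" "m < 3" "n \<noteq> m" "m = n + 1 \<or> n = 2 \<and> m = 0"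
      and K: "\<And>W j. j < 3 \<and> L W j = Some k \<longleftrightarrow> (W, j) = (U, n) \<or> (W, j) = (U, m)" for n m
  proof -
    have L: "L U (n + 1) = L U m" "L U (m + 1) = L U (n + 2)" "L U (m + 2) = L U n"
      using n periodic[of U 0] periodic[of U 1] periodic[of U n] by (auto simp: eval_nat_numeral)
    have "(U, n) \<noteq> (U, m)" using n by simp
    from outs_corner_arrows[OF K this] ins_corner_arrows[OF K this]
    have o: "outs (corner_arrows L) k = mset_option (L U m) + mset_option (L U (n + 2))"
      and i: "ins (corner_arrows L) k = mset_option (L U (n + 2)) + mset_option (L U n)"
      unfolding L .
    have "L U (n + 2) = None"
    proof (rule ccontr)
      assume "L U (n + 2) \<noteq> None"
      then obtain x where x: "L U (n + 2) = Some x" by blast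
      with disj[of x] have "x = k"
        by (auto simp: o i mset_option_def)
      \<comment> \<open>Side \<open>n + 2\<close> with an index below 3, as \<open>K\<close>
        requires; it would be a third side carrying \<open>k\<close>.\<close>
      define l where "l = (if n = 0 then 2 else n - 1)"
      have l: "L U l = L U (n + 2)" "l < 3" "l \<noteq> n" "l \<noteq> m"
        using n by (auto simp: l_def eval_nat_numeral less_Suc_eq)
      from K[of l U] x \<open>x = k\<close> l show False by simp
    qed
    with assms(4) show False by (simp add: o i of_bool_def split: if_splits)
  qed
  have "m = n + 1 \<or> n = m + 1 \<or> n = 0 \<and> m = 2 \<or> n = 2 \<and> m = 0"
    using nm(1,2) ne \<open>U = V\<close> by auto
  moreover have "n \<noteq> m" using ne \<open>U = V\<close> by simp
  ultimately consider "m = n + 1 \<or> n = 2 \<and> m = 0" "n \<noteq> m" | "n = m + 1 \<or> m = 2 \<and> n = 0" "m \<noteq> n" by auto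
  then show False
  proof cases
    case 1
    show False by (rule *[OF nm(1,2) 1(2,1)]) (simp add: K \<open>U = V\<close>)
  next
    case 2
    show False by (rule *[OF nm(2,1) 2(2,1)]) (subst K, use \<open>U = V\<close> in blast)
  qed
qed

lemma L_mod: "L U (j mod 3) = L U j"
proof (induction j rule: less_induct)
  case (less j)
  show ?case
  proof (cases "j < 3")
    case False
    then obtain i where "j = i + 3" by (metis le_add_diff_inverse2 not_less)
    with less[of i] show ?thesis by simp
  qed simp
qed

lemma (in -) add_mod_3_neq: "(n + 1) mod 3 \<noteq> n mod (3 :: nat)" "(n + 2) mod 3 \<noteq> n mod (3 :: nat)"
  by presburger+

text \<open>Of the three corners of \<open>U\<close>, two involve side \<open>n\<close>, which
  carries \<open>k\<close>. A corner between arcs other than \<open>k\<close> must be the opposite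
  one, between sides \<open>n + 1\<close> and \<open>n + 2\<close>.\<close>

lemma corner_position:
  assumes "L U n = Some k" "L U j = Some y" "L U (j + 1) = Some x" "y \<noteq> k" "x \<noteq> k"
  shows "L U (n + 1) = Some y \<and> L U (n + 2) = Some x \<and> j mod 3 = (n + 1) mod 3"
proof -
  have "j mod 3 < 3" "n mod 3 < 3" by simp_all
  then have "j mod 3 = n mod 3 \<or> (j + 1) mod 3 = n mod 3 \<or> j mod 3 = (n + 1) mod 3"
    by (simp add: mod_Suc) linarith
  moreover have L_eq: "L U i = L U l" if "i mod 3 = l mod 3" for i l
    using arg_cong[OF that, of "L U"] by (simp only: L_mod)
  ultimately have *: "j mod 3 = (n + 1) mod 3"
    using L_eq[of j n] L_eq[of "j + 1" n] assms(1-5) by (metis option.inject)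
  then have "(j + 1) mod 3 = (n + 2) mod 3" by (simp add: mod_Suc)
  from L_eq[OF this] L_eq[OF *] * show ?thesis using assms by simp
qed

lemma two_triangles: "distinct [U, V, W] \<Longrightarrow> L U n = Some a \<Longrightarrow> L V m = Some a \<Longrightarrow> L W l = Some a \<Longrightarrow> False"
  using two_sides[of U "n mod 3" a V "m mod 3" W "l mod 3"] by (simp add: L_mod)

text \<open>The left side is the number of 2-cycles formed by arrows y -> x of the quiver and
  composites x -> k -> y. The right side counts the triangles at \<open>k\<close> whose remaining
  sides are y and x, in this order. A further triangle with such a corner makes both sides equal to
  1; otherwise the corners are exactly those opposite to \<open>k\<close>, and there are at least as
  many composites.\<close>

lemma corner_count:
  assumes UV: "U \<noteq> V" and L: "L U n = Some k" "L V m = Some k" "n < 3" "m < 3"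
    and nk: "L U (n + 1) = Some y \<or> L V (m + 1) = Some y \<Longrightarrow> y \<noteq> k"
      "L U (n + 2) = Some x \<or> L V (m + 2) = Some x \<Longrightarrow> x \<noteq> k"
    and ne: "L U (n + 1) = Some y \<or> L V (m + 1) = Some y \<Longrightarrow> L U (n + 2) = Some x \<or> L V (m + 2) = Some x \<Longrightarrow> y \<noteq> x"
  shows "min (card {(W, j). j < 3 \<and> L W j = Some y \<and> L W (j + 1) = Some x}
        - (if y = x then 0 else card {(W, j). j < 3 \<and> L W j = Some x \<and> L W (j + 1) = Some y}))
      ((of_bool (L U (n + 2) = Some x) + of_bool (L V (m + 2) = Some x)) *
       (of_bool (L U (n + 1) = Some y) + of_bool (L V (m + 1) = Some y)))
    = of_bool (L U (n + 1) = Some y \<and> L U (n + 2) = Some x) + of_bool (L V (m + 1) = Some y \<and> L V (m + 2) = Some x)"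
    (is "min (card ?P - (if _ then _ else card ?P')) (?I * ?O) = of_bool ?dU + of_bool ?dV")
proof (cases "?O = (0 :: nat) \<or> ?I = (0 :: nat)")
  case True
  then show ?thesis
    by (cases "L U (n + 1) = Some y"; cases "L U (n + 2) = Some x"; cases "L V (m + 1) = Some y"; cases "L V (m + 2) = Some x"; simp)
next
  case False
  then have yO: "L U (n + 1) = Some y \<or> L V (m + 1) = Some y" and xI: "L U (n + 2) = Some x \<or> L V (m + 2) = Some x"
    by (auto simp: of_bool_def split: if_splits)
  note ne = ne[OF yO xI] nk(1)[OF yO] nk(2)[OF xI]
  let ?sU = "(U, (n + 1) mod 3)" and ?sV = "(V, (m + 1) mod 3)"
  have PU: "?dU \<and> j = (n + 1) mod 3" if "(U, j) \<in> ?P" for j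
    using corner_position[OF L(1), of j y x] that ne by auto
  have PV: "?dV \<and> j = (m + 1) mod 3" if "(V, j) \<in> ?P" for j
    using corner_position[OF L(2), of j y x] that ne by auto
  have L_Suc: "L W ((j + 1) mod 3 + 1) = L W (j + 2)" for W j
  proof -
    have "((j + 1) mod 3 + 1) mod 3 = (j + 2) mod 3" by (simp add: mod_Suc)
    from arg_cong[OF this, of "L W"] show ?thesis by (simp only: L_mod)
  qed
  have U': "?sU \<in> ?P" if ?dU
    unfolding mem_Collect_eq prod.case L_Suc L_mod using that by simp
  have V': "?sV \<in> ?P" if ?dV
    unfolding mem_Collect_eq prod.case L_Suc L_mod using that by simp
  \<comment> \<open>A corner x, y in another triangle closes up with the given corner y, x to a
    corner 2-cycle. In the same triangle both would have to be the corner opposite to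
    \<open>k\<close>, so x and y would agree.\<close>
  have no_back: "?P' = {}" if d: "?dU \<or> ?dV"
  proof -
    have False if P': "L W j = Some x" "L W (j + 1) = Some y" for W j
    proof -
      have "W \<noteq> U" if ?dU using corner_position[OF L(1), of j x y] P' ne that by auto
      moreover have "W \<noteq> V" if ?dV using corner_position[OF L(2), of j x y] P' ne that by auto
      ultimately show False
        using d no_corner_2cycle[of U W y x "n + 1" j] no_corner_2cycle[of V W y x "m + 1" j] P' ne(1) by auto
    qed
    then show ?thesis by blast
  qed
  \<comment> \<open>In a third triangle, y and x each use up one of their two sides, so each occurs
    only once next to \<open>k\<close>. If they occurred in different triangles at \<open>k\<close>,
    these would form a corner 3-cycle with the third one. Hence exactly one triangle at
    \<open>k\<close> has both.\<close>
  have extra: "?O = (1 :: nat) \<and> ?I = (1 :: nat) \<and> (of_bool ?dU + of_bool ?dV) = (1 :: nat)"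
    if P: "(W, j) \<in> ?P" and W: "W \<noteq> U" "W \<noteq> V" for W j
  proof -
    from P have W': "L W j = Some y" "L W (j + 1) = Some x" by auto
    have d: "distinct [U, V, W]" using UV W by auto
    have "\<not> (L U (n + 1) = Some y \<and> L V (m + 1) = Some y)"
      using two_triangles[OF d _ _ W'(1)] by blast
    moreover have "\<not> (L U (n + 2) = Some x \<and> L V (m + 2) = Some x)"
      using two_triangles[OF d _ _ W'(2)] by blast
    moreover have "\<not> (L U (n + 1) = Some y \<and> L V (m + 2) = Some x)"
      using no_corner_3cycle[of U W V k y x n j "m + 2"] d ne L W' by auto
    moreover have "\<not> (L V (m + 1) = Some y \<and> L U (n + 2) = Some x)"
      using no_corner_3cycle[of V W U k y x m j "n + 2"] d ne L W' by auto
    ultimately show ?thesis using yO xI by auto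
  qed
  have fin: "finite ?P" by (rule finite_corner)
  show ?thesis
  proof (cases "?dU \<or> ?dV")
    case d: True
    have I1: "?I \<ge> (1 :: nat)" "?O \<ge> (1 :: nat)" using False by linarith+
    show ?thesis
    proof (cases "\<exists>W j. (W, j) \<in> ?P \<and> W \<noteq> U \<and> W \<noteq> V")
      case True
      then have "?P \<noteq> {}" by blast
      then have "card ?P \<ge> 1" using fin by (simp add: Suc_le_eq card_gt_0_iff)
      moreover obtain W j where "(W, j) \<in> ?P" "W \<noteq> U" "W \<noteq> V" using True by blast
      note extra[OF this]
      ultimately show ?thesis unfolding no_back[OF d] using ne(1) by simp
    next
      case no_extra: False
      have "?P = (if ?dU then {?sU} else {}) \<union> (if ?dV then {?sV} else {})" (is "_ = ?R")
      proof (rule set_eqI)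
        fix s :: "'u \<times> nat"
        obtain W j where s: "s = (W, j)" by fastforce
        show "s \<in> ?P \<longleftrightarrow> s \<in> ?R"
        proof
          assume "s \<in> ?P"
          with no_extra PU[of j] PV[of j] s show "s \<in> ?R" by (cases "W = U"; cases "W = V") auto
        next
          assume "s \<in> ?R"
          with U' V' show "s \<in> ?P" by (auto split: if_splits)
        qed
      qed
      then have "card ?P = of_bool ?dU + of_bool ?dV" using UV by simp
      moreover have "of_bool ?dU + of_bool ?dV \<le> ?I * (?O :: nat)"
        using I1 by (auto simp: of_bool_def)
      ultimately show ?thesis unfolding no_back[OF d] using ne(1) by simp
    qed
  next
    case d: False
    have "?P = {}"
    proof (rule ccontr)
      assume "?P \<noteq> {}"
      then obtain W j where P: "(W, j) \<in> ?P" by blast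
      with PU[of j] PV[of j] d extra[OF P] show False by (cases "W = U"; cases "W = V") auto
    qed
    then have 0: "card ?P = 0" by (simp only: card.empty)
    show ?thesis unfolding 0 using d by simp
  qed
qed

lemma num_arrows_mutation_eq:
  fixes Q :: "'a quiver"
  assumes Q: "arrows Q = cancel_2cycles (corner_arrows L)"
    and deg: "\<not> (in_degree Q k = 1 \<and> out_degree Q k = 1)"
  shows "num_arrows (mutation k Q) = num_arrows Q"
proof -
  let ?E = "corner_arrows L"
  define Os where "Os = outs ?E k"
  define Is where "Is = ins ?E k"
  define Os' where "Os' = outs (arrows Q) k"
  define Is' where "Is' = ins (arrows Q) k"
  have cQ: "count (arrows Q) (x, y) = count ?E (x, y) - (if x = y then 0 else count ?E (y, x))" for x y
    by (simp add: Q count_cancel_2cycles)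
  have no2: "no_2cycles (arrows Q)"
    by (simp add: Q no_2cycles_cancel_2cycles)
  have Os: "count Os y = count ?E (k, y)" and Is: "count Is y = count ?E (y, k)"
    and Os': "count Os' y = count (arrows Q) (k, y)" and Is': "count Is' y = count (arrows Q) (y, k)" for y
    by (simp_all add: Os_def Is_def Os'_def Is'_def count_out count_in)
  have sO: "size Os' = out_degree Q k" and sI: "size Is' = in_degree Q k"
    by (simp_all add: Os'_def Is'_def in_degree_def out_degree_def)
  have le: "Os' \<subseteq># Os" "Is' \<subseteq># Is"
    by (auto intro!: mset_subset_eqI simp: Os Is Os' Is' cQ)
  note size_le = size_mset_mono[OF le(1)] size_mset_mono[OF le(2)]
  show ?thesis
  proof (cases "in_degree Q k = 0 \<or> out_degree Q k = 0")
    case True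
    then have "Os' = {#} \<or> Is' = {#}" using sO sI by auto
    then have "(k, k) \<notin># arrows Q"
      using Os'[of k] Is'[of k] by (auto simp: count_eq_zero_iff)
    moreover have "composite_arrows k (arrows Q) = {#}"
      using size_composite_arrows[of k Q] True by (metis mult_eq_0_iff size_eq_0_iff_empty)
    ultimately show ?thesis using num_arrows_mutation[OF no2, of k] True by auto
  next
    case False
    \<comment> \<open>Neither degree is 0 and they are not both 1.\<close>
    with deg sO sI have ge3: "size Os' + size Is' \<ge> 3" "size Os' \<ge> 1" "size Is' \<ge> 1" by linarith+
    obtain U n V m where ne: "(U, n) \<noteq> (V, m)"
        and K: "\<And>W j. j < 3 \<and> L W j = Some k \<longleftrightarrow> (W, j) = (U, n) \<or> (W, j) = (V, m)"
    proof (cases rule: sides_cases[of k])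
      case (1 U n)
      have "size Os \<le> 1" "size Is \<le> 1"
        unfolding Os_def Is_def by (rule degrees_le_1[where k = k, OF 1]; assumption)+
      with ge3 size_le show ?thesis by linarith
    qed (rule that)
    have Oeq: "Os = mset_option (L U (n + 1)) + mset_option (L V (m + 1))"
      and Ieq: "Is = mset_option (L U (n + 2)) + mset_option (L V (m + 2))"
      using outs_corner_arrows[OF K ne] ins_corner_arrows[OF K ne] by (simp_all add: Os_def Is_def)
    have le2: "size Os \<le> 2" "size Is \<le> 2"
      by (simp_all add: Oeq Ieq of_bool_def)
    \<comment> \<open>An arc on both sides of the relation would cost \<open>k\<close> at least one
      outgoing and one incoming arrow. Starting from at most 2 each, at most 1 each would be left,
      against \<open>ge3\<close>.\<close>
    have disj: "y \<notin># Is" if "y \<noteq> k" "y \<in># Os" for y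
    proof
      assume "y \<in># Is"
      have "count Os' y < count Os y" "count Is' y < count Is y"
        using that \<open>y \<in># Is\<close> by (auto simp: Os Is Os' Is' cQ count_greater_zero_iff[symmetric] simp del: count_greater_zero_iff)
      then have "Os' \<subset># Os" "Is' \<subset># Is" using le by (auto simp: subset_mset.less_le)
      then have "size Os' < size Os" "size Is' < size Is" by (simp_all add: mset_subset_size)
      with ge3 le2 show False by linarith
    qed
    have UV: "U \<noteq> V"
      by (rule distinct_triangles[OF K ne]) (use disj ge3 size_le in \<open>auto simp: Os_def Is_def\<close>)
    have "n < 3 \<and> L U n = Some k" "m < 3 \<and> L V m = Some k" by (rule K[THEN iffD2]; simp)+
    then have L: "L U n = Some k" "L V m = Some k" "n < 3" "m < 3" by blast+
    have nk: "L U (n + 1) \<noteq> Some k" "L U (n + 2) \<noteq> Some k" "L V (m + 1) \<noteq> Some k" "L V (m + 2) \<noteq> Some k"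
    proof -
      have "j mod 3 = n mod 3" if "L U j = Some k" for j
        using iffD1[OF K, of "j mod 3" U] that UV \<open>n < 3\<close> by (simp only: L_mod prod.inject) simp
      then show "L U (n + 1) \<noteq> Some k" "L U (n + 2) \<noteq> Some k"
        using add_mod_3_neq[of n] by fastforce+
      have "j mod 3 = m mod 3" if "L V j = Some k" for j
        using iffD1[OF K, of "j mod 3" V] that UV \<open>m < 3\<close> by (simp only: L_mod prod.inject) simp
      then show "L V (m + 1) \<noteq> Some k" "L V (m + 2) \<noteq> Some k"
        using add_mod_3_neq[of m] by fastforce+
    qed
    have nkO: "y \<noteq> k" if "y \<in># Os" for y using that nk by (auto simp: Oeq mset_option_def split: option.splits)
    have nkI: "y \<noteq> k" if "y \<in># Is" for y using that nk by (auto simp: Ieq mset_option_def split: option.splits)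
    have "Os' = Os"
    proof (rule multiset_eqI)
      fix y show "count Os' y = count Os y"
        using disj[of y] nkO[of y] by (cases "y \<in># Os") (auto simp: Os' cQ Os[symmetric] Is[symmetric] not_in_iff)
    qed
    have "Is' = Is"
    proof (rule multiset_eqI)
      fix y show "count Is' y = count Is y"
        using disj[of y] nkI[of y] by (cases "y \<in># Is"; cases "y \<in># Os") (auto simp: Is' cQ Os[symmetric] Is[symmetric] not_in_iff)
    qed
    have kk: "(k, k) \<notin># arrows Q"
      using nkO[of k] Os'[of k] \<open>Os' = Os\<close> by (metis not_in_iff)
    \<comment> \<open>The arrows opposite to \<open>k\<close> in its two triangles; below they turn
      out to be exactly the old arrows that mutation cancels.\<close>
    define D where "D = mset_option (pair_option (L U (n + 1)) (L U (n + 2))) + mset_option (pair_option (L V (m + 1)) (L V (m + 2)))"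
    have D: "count D (y, x) = of_bool (L U (n + 1) = Some y \<and> L U (n + 2) = Some x) + of_bool (L V (m + 1) = Some y \<and> L V (m + 2) = Some x)" for x y
      by (simp add: D_def)
    have cO: "count Os y = of_bool (L U (n + 1) = Some y) + of_bool (L V (m + 1) = Some y)" for y
      by (simp add: Oeq)
    have cI: "count Is x = of_bool (L U (n + 2) = Some x) + of_bool (L V (m + 2) = Some x)" for x
      by (simp add: Ieq)
    \<comment> \<open>The possible pairs of degrees are (2,2), (2,1) and (1,2): with four
      neighbouring arcs there are two opposite arrows against four composites, with three arcs one
      against two.\<close>
    have "size D * 2 = size Is * size Os"
      using ge3 unfolding \<open>Os' = Os\<close> \<open>Is' = Is\<close>
      by (auto simp: D_def Oeq Ieq of_bool_def split: if_splits)
    moreover have "arrows Q \<inter># image_mset prod.swap (composite_arrows k (arrows Q)) = D"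
    proof (rule multiset_eqI)
      fix e :: "'a \<times> 'a"
      obtain y x where e: "e = (y, x)" by fastforce
      let ?C = "count Is x * count Os y"
      have "count (image_mset prod.swap (composite_arrows k (arrows Q))) e = ?C"
        unfolding e count_image_swap count_composite_arrows
        by (simp add: Os'[symmetric] Is'[symmetric] \<open>Os' = Os\<close> \<open>Is' = Is\<close>)
      moreover have "min (count (arrows Q) (y, x)) ?C = count D (y, x)"
        unfolding cO cI D cQ count_corner_arrows
      proof (rule corner_count[OF UV L])
        show "y \<noteq> k" if "L U (n + 1) = Some y \<or> L V (m + 1) = Some y" using that nk by auto
        show "x \<noteq> k" if "L U (n + 2) = Some x \<or> L V (m + 2) = Some x" using that nk by auto
        show "y \<noteq> x" if "L U (n + 1) = Some y \<or> L V (m + 1) = Some y" "L U (n + 2) = Some x \<or> L V (m + 2) = Some x"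
        proof -
          have "y \<in># Os" "x \<in># Is" using that
            by (auto simp: count_greater_zero_iff[symmetric] cO cI simp del: count_greater_zero_iff)
          then show ?thesis using disj[of y] nkO[of y] by auto
        qed
      qed
      ultimately show "count (arrows Q \<inter># image_mset prod.swap (composite_arrows k (arrows Q))) e = count D e"
        unfolding e by simp
    qed
    ultimately show ?thesis
      using num_arrows_mutation[OF no2 kk] sO sI \<open>Os' = Os\<close> \<open>Is' = Is\<close> by simp
  qed
qed

end

section \<open>Injections of planar domains into surfaces\<close>

lemma chart_compose:
  fixes h :: "complex \<Rightarrow> 'a"
  assumes "chart X U \<phi>" and B: "open B" and h: "continuous_map (top_of_set B) X h" "inj_on h B"
  defines "B' \<equiv> {z \<in> B. h z \<in> U}"
  shows "open B'" "continuous_on B' (\<phi> \<circ> h)" "inj_on (\<phi> \<circ> h) B'"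
proof -
  from assms obtain V where U: "openin X U"
    and \<phi>: "homeomorphic_map (subtopology X U) (top_of_set V) \<phi>"
    by (auto simp: chart_def)
  have Utop: "topspace (subtopology X U) = U" using U openin_subset by (auto simp: topspace_subtopology)
  have "openin (top_of_set B) B'"
    using openin_continuous_map_preimage[OF h(1) U] by (simp add: B'_def)
  then show "open B'" using B openin_open_trans by blast
  have "continuous_map (top_of_set B') X h"
    using continuous_map_from_subtopology_mono[OF h(1), of B'] by (auto simp: B'_def)
  then have "continuous_map (top_of_set B') (subtopology X U) h"
    by (rule continuous_map_into_subtopology) (auto simp: B'_def)
  then have "continuous_map (top_of_set B') (top_of_set V) (\<phi> \<circ> h)"
    using \<phi> continuous_map_compose homeomorphic_imp_continuous_map by blast
  then show "continuous_on B' (\<phi> \<circ> h)"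
    by (auto simp: continuous_map_in_subtopology)
  have "inj_on \<phi> U"
    using homeomorphic_imp_injective_map[OF \<phi>] by (simp only: Utop)
  then show "inj_on (\<phi> \<circ> h) B'"
    by (intro comp_inj_on inj_on_subset[OF h(2)]) (auto intro: inj_on_subset simp: B'_def)
qed

text \<open>Invariance of domain for \<open>\<phi> \<circ> h\<close> makes the image open in the
  plane, not merely in the half plane. It is then open in \<open>V\<close> and can be pulled back
  along the chart.\<close>

lemma chart_image:
  fixes h :: "complex \<Rightarrow> 'a"
  assumes chart: "chart X U \<phi>" and B: "open B" and h: "continuous_map (top_of_set B) X h" "inj_on h B"
  defines "B' \<equiv> {z \<in> B. h z \<in> U}"
  shows "openin X (h ` B')" "open (\<phi> ` h ` B')" "\<phi> ` h ` B' \<subseteq> half_plane"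
proof -
  from chart obtain V where U: "openin X U" and V: "openin (top_of_set half_plane) V"
    and \<phi>: "homeomorphic_map (subtopology X U) (top_of_set V) \<phi>"
    by (auto simp: chart_def)
  have Utop: "topspace (subtopology X U) = U" using U openin_subset by (auto simp: topspace_subtopology)
  have inj\<phi>: "inj_on \<phi> U" and surj\<phi>: "\<phi> ` U = V"
    using homeomorphic_imp_injective_map[OF \<phi>] homeomorphic_imp_surjective_map[OF \<phi>] by (simp_all only: Utop topspace_euclidean_subtopology)
  note B' = chart_compose[OF chart B h, folded B'_def]
  from invariance_of_domain[OF B'(2,1,3)] show W: "open (\<phi> ` h ` B')" by (simp add: image_comp)
  have sub: "\<phi> ` h ` B' \<subseteq> V" using surj\<phi> by (auto simp: B'_def)
  then show "\<phi> ` h ` B' \<subseteq> half_plane"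
    using openin_imp_subset[OF V] by blast
  have "openin (top_of_set V) (\<phi> ` h ` B')"
    using W sub by (metis open_subset)
  from openin_continuous_map_preimage[OF homeomorphic_imp_continuous_map[OF \<phi>] this]
  have "openin (subtopology X U) {x \<in> U. \<phi> x \<in> \<phi> ` h ` B'}" by (simp only: Utop)
  moreover have "{x \<in> U. \<phi> x \<in> \<phi> ` h ` B'} = h ` B'"
    using inj\<phi> by (auto simp: B'_def inj_on_def)
  ultimately show "openin X (h ` B')" using U openin_trans_full by metis
qed

lemma open_image:
  fixes h :: "complex \<Rightarrow> 'a"
  assumes "surface X" "open B" "continuous_map (top_of_set B) X h" "inj_on h B"
  shows "openin X (h ` B)"
proof (subst openin_subopen, intro ballI)
  fix x assume "x \<in> h ` B"
  then obtain z where z: "z \<in> B" "x = h z" by blast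
  have "x \<in> topspace X" using assms(3) z by (auto simp: continuous_map_def)
  then obtain U \<phi> where "chart X U \<phi>" "x \<in> U" using assms(1) unfolding surface_def by blast
  with chart_image(1)[OF _ assms(2-4)] z show "\<exists>T. openin X T \<and> x \<in> T \<and> T \<subseteq> h ` B"
    by (intro exI[of _ "h ` {z \<in> B. h z \<in> U}"]) auto
qed

text \<open>In any chart the image would contain a full disc around a real point, hence points below
  the real axis. Every chart has to be considered, since a boundary point is one that some chart
  sends to the real axis.\<close>

lemma image_not_boundary:
  fixes h :: "complex \<Rightarrow> 'a"
  assumes "open B" "continuous_map (top_of_set B) X h" "inj_on h B"
  shows "h ` B \<inter> boundary X = {}"
proof -
  have False if z: "z \<in> B" and c: "chart X U \<phi>" "h z \<in> U" "Im (\<phi> (h z)) = 0" for z U \<phi>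
  proof -
    let ?W = "\<phi> ` h ` {z \<in> B. h z \<in> U}"
    have "open ?W" "?W \<subseteq> half_plane" "\<phi> (h z) \<in> ?W"
      using chart_image[OF c(1) assms] z c by auto
    then obtain e where e: "e > 0" "ball (\<phi> (h z)) e \<subseteq> half_plane" by (metis open_contains_ball subset_trans)
    have "cmod (\<i> * of_real (e / 2)) = e / 2" using e(1) by (subst norm_mult) simp
    then have "\<phi> (h z) - \<i> * of_real (e / 2) \<in> ball (\<phi> (h z)) e"
      using e(1) by (simp only: dist_norm mem_ball) simp
    then have "\<phi> (h z) - \<i> * of_real (e / 2) \<in> half_plane" using e(2) by blast
    then have "0 \<le> Im (\<phi> (h z) - \<i> * of_real (e / 2))" by (simp only: half_plane_def mem_Collect_eq)
    with c e(1) show False by simp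
  qed
  then show ?thesis by (auto simp: boundary_def)
qed

text \<open>\<open>disj\<close> compares only the open half discs. If one of the points lies on the
  real axis, \<open>eq\<close> carries it over to the other half, where injectivity is
  known.\<close>

lemma glue_half_discs:
  fixes F G :: "complex \<Rightarrow> 'a"
  assumes F: "continuous_map (top_of_set (D \<inter> {z. Im z \<ge> 0})) X F" "inj_on F (D \<inter> {z. Im z \<ge> 0})"
    and G: "continuous_map (top_of_set (D \<inter> {z. Im z \<le> 0})) X G" "inj_on G (D \<inter> {z. Im z \<le> 0})"
    and eq: "\<And>z. z \<in> D \<Longrightarrow> Im z = 0 \<Longrightarrow> F z = G z"
    and disj: "\<And>z w. z \<in> D \<Longrightarrow> w \<in> D \<Longrightarrow> Im z > 0 \<Longrightarrow> Im w < 0 \<Longrightarrow> F z \<noteq> G w"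
  shows "continuous_map (top_of_set D) X (\<lambda>z. if 0 \<le> Im z then F z else G z)"
    "inj_on (\<lambda>z. if 0 \<le> Im z then F z else G z) D"
proof -
  have 1: "subtopology (top_of_set D) {x \<in> topspace (top_of_set D). 0 \<le> Im x} = top_of_set (D \<inter> {z. Im z \<ge> 0})"
    and 2: "subtopology (top_of_set D) {x \<in> topspace (top_of_set D). Im x \<le> 0} = top_of_set (D \<inter> {z. Im z \<le> 0})"
    by (simp_all add: subtopology_subtopology Int_def)
  show "continuous_map (top_of_set D) X (\<lambda>z. if 0 \<le> Im z then F z else G z)"
    by (rule continuous_map_cases_le) (use F(1) G(1) eq in \<open>simp_all only: 1 2\<close>, auto intro: continuous_intros)
  show "inj_on (\<lambda>z. if 0 \<le> Im z then F z else G z) D"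
  proof (rule inj_onI)
    have *: False if "z \<in> D" "w \<in> D" "0 \<le> Im z" "Im w < 0" "F z = G w" for z w
    proof (cases "Im z = 0")
      case True
      with eq that have "G z = G w" by simp
      with G(2) that True have "z = w" by (auto simp: inj_on_def)
      with that show False by simp
    next
      case False
      with disj that show False by force
    qed
    fix z w
    assume zw: "z \<in> D" "w \<in> D" "(if 0 \<le> Im z then F z else G z) = (if 0 \<le> Im w then F w else G w)"
    then show "z = w"
      using *[of z w] *[of w z] inj_onD[OF F(2), of z w] inj_onD[OF G(2), of z w]
      by (auto split: if_splits)
  qed
qed

section \<open>Reparametrization of curves with the same interior\<close>

text \<open>A monotone surjection of the line has no jumps, hence is continuous. The identity
  outside the unit interval makes it a map of the whole line, so that later arguments need no care
  about domains.\<close>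

lemma strict_mono_extension:
  fixes s :: "real \<Rightarrow> real"
  assumes "strict_mono_on {0<..<1} s" "s ` {0<..<1} = {0<..<1}"
  defines "\<tau> \<equiv> \<lambda>t. if 0 < t \<and> t < 1 then s t else t"
  shows "continuous_on UNIV \<tau>" "strict_mono \<tau>"
proof -
  have r: "0 < s t \<and> s t < 1" if "0 < t" "t < 1" for t
    using assms(2) that by (metis greaterThanLessThan_iff imageI)
  show sm: "strict_mono \<tau>"
  proof (rule strict_monoI)
    fix x y :: real assume "x < y"
    then show "\<tau> x < \<tau> y" using r[of x] r[of y] strict_mono_onD[OF assms(1), of x y] by (auto simp: \<tau>_def)
  qed
  have "y \<in> range \<tau>" for y
  proof (cases "0 < y \<and> y < 1")
    case True
    then obtain t where "t \<in> {0<..<1}" "y = s t" using assms(2) by (metis greaterThanLessThan_iff imageE)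
    then show ?thesis by (auto simp: \<tau>_def image_def)
  next
    case False
    then have "y = \<tau> y" by (auto simp: \<tau>_def)
    then show ?thesis by blast
  qed
  then have "range \<tau> = UNIV" by blast
  with sm show "continuous_on UNIV \<tau>"
    by (intro continuous_onI_mono) (auto simp: strict_mono_less_eq)
qed

text \<open>The change of parameter \<open>s\<close> is defined on the open interval only, because
  the endpoints of an arc may coincide. It is continuous because compact sets have closed images in
  a Hausdorff space, and a continuous injection of an interval is monotone; the two directions are
  the two alternatives.\<close>

lemma reparametrization:
  assumes X: "Hausdorff_space X" and P: "pathin X P" "inj_on P {0<..<1}" and R: "pathin X R" "inj_on R {0<..<1}"
    and eq: "P ` {0<..<1} = R ` {0<..<1}"
    and ends: "P 0 \<notin> P ` {0<..<1}" "P 1 \<notin> P ` {0<..<1}" "R 0 \<notin> P ` {0<..<1}" "R 1 \<notin> P ` {0<..<1}"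
  obtains \<tau> where "continuous_on UNIV \<tau>" "strict_mono \<tau>" "\<tau> 0 = (0::real)" "\<tau> 1 = (1::real)"
    "(\<forall>t \<in> {0..1}. P t = R (\<tau> t)) \<or> (\<forall>t \<in> {0..1}. P t = R (1 - \<tau> t))"
proof -
  define s where "s t = inv_into {0<..<1} R (P t)" for t
  have s: "s t \<in> {0<..<1} \<and> R (s t) = P t" if "t \<in> {0<..<1}" for t
  proof -
    have "P t \<in> R ` {0<..<1}" using that eq by blast
    then show ?thesis unfolding s_def by (meson f_inv_into_f inv_into_into)
  qed
  have inj: "inj_on s {0<..<1}"
    using P(2) s by (metis (no_types, lifting) inj_on_def)
  have surj: "s ` {0<..<1} = {0<..<1}"
  proof
    show "{0<..<1} \<subseteq> s ` {0<..<1}"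
    proof
      fix r :: real assume r: "r \<in> {0<..<1}"
      then obtain t where t: "t \<in> {0<..<1}" "R r = P t" using eq by (metis imageE imageI)
      then have "s t = r" using R(2) s[OF t(1)] r by (metis inj_onD)
      with t show "r \<in> s ` {0<..<1}" by blast
    qed
  qed (use s in blast)
  have cont: "continuous_on {0<..<1} s"
    unfolding continuous_closedin_preimage_eq
  proof (intro allI impI)
    fix T :: "real set" assume T: "closed T"
    \<comment> \<open>Compactness requires the closed interval; the additional values at the ends do
      no harm, since \<open>R 0\<close> and \<open>R 1\<close> do not lie on the open curve.\<close>
    have "compactin (top_of_set {0..1}) (T \<inter> {0..1})"
      using T by (auto simp: compactin_subtopology)
    then have "closedin X (R ` (T \<inter> {0..1}))"
      using R(1) X compactin_imp_closedin image_compactin unfolding pathin_def by blast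
    then have "closedin (top_of_set {0..1}) {t \<in> {0..1}. P t \<in> R ` (T \<inter> {0..1})}"
      using closedin_continuous_map_preimage[of "top_of_set {0..1}" X P] P(1) by (simp add: pathin_def)
    then have "closed {t \<in> {0..1}. P t \<in> R ` (T \<inter> {0..1})}" using closedin_closed_trans by blast
    moreover have "{0<..<1} \<inter> s -` T = {0<..<1} \<inter> {t \<in> {0..1}. P t \<in> R ` (T \<inter> {0..1})}"
    proof (intro set_eqI iffI)
      fix t assume t: "t \<in> {0<..<1} \<inter> s -` T"
      then have "s t \<in> T \<inter> {0..1}" "R (s t) = P t" using s[of t] by auto
      then have "P t \<in> R ` (T \<inter> {0..1})" by (metis imageI)
      with t show "t \<in> {0<..<1} \<inter> {t \<in> {0..1}. P t \<in> R ` (T \<inter> {0..1})}" by auto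
    next
      fix t assume t: "t \<in> {0<..<1} \<inter> {t \<in> {0..1}. P t \<in> R ` (T \<inter> {0..1})}"
      then obtain r where r: "r \<in> T" "0 \<le> r" "r \<le> 1" "P t = R r" by auto
      have "P t \<in> P ` {0<..<1}" using t by blast
      then have "r \<noteq> 0" "r \<noteq> 1" using r(4) ends(3,4) by auto
      with r have "r \<in> {0<..<1}" by auto
      moreover have "s t \<in> {0<..<1}" "R (s t) = R r" using s[of t] t r(4) by auto
      ultimately have "s t = r" using inj_onD[OF R(2)] by blast
      with t r show "t \<in> {0<..<1} \<inter> s -` T" by auto
    qed
    ultimately show "closedin (top_of_set {0<..<1}) ({0<..<1} \<inter> s -` T)"
      by (metis closedin_closed)
  qed
  \<comment> \<open>Stated for an arbitrary increasing change of parameter, in order to serve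
    \<open>R\<close> itself and \<open>R\<close> run backwards.\<close>
  have main: "\<exists>\<tau>. continuous_on UNIV \<tau> \<and> strict_mono \<tau> \<and> \<tau> 0 = 0 \<and> \<tau> 1 = 1 \<and> (\<forall>t \<in> {0..1}. P t = R' (\<tau> t))"
    if R': "pathin X R'" and mono: "strict_mono_on {0<..<1} s'" and surj: "s' ` {0<..<1} = {0<..<1}"
      and eq: "\<And>t. t \<in> {0<..<1} \<Longrightarrow> R' (s' t) = P t" for R' and s' :: "real \<Rightarrow> real"
  proof -
    let ?\<tau> = "\<lambda>t. if 0 < t \<and> t < 1 then s' t else t"
    note \<tau> = strict_mono_extension[OF mono surj]
    \<comment> \<open>Both sides are continuous into a Hausdorff space and agree on the open
      interval, which is dense.\<close>
    have "P t = (R' \<circ> ?\<tau>) t" if t: "t \<in> {0..1}" for t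
    proof (rule forall_in_closure_of_eq[of t "top_of_set {0..1}" "{0<..<1}" X])
      show "t \<in> top_of_set {0..1} closure_of {0<..<1}"
        using t by (simp add: closure_of_subtopology Int_absorb1 greaterThanLessThan_subseteq_atLeastAtMost_iff)
      have *: "?\<tau> t \<in> {0..1}" if "t \<in> {0..1}" for t
      proof -
        have "t \<in> {0<..<1} \<Longrightarrow> s' t \<in> {0<..<1}" using surj by blast
        with that show ?thesis by auto
      qed
      have "continuous_map (top_of_set {0..1}) (top_of_set {0..1}) ?\<tau>"
      proof (rule continuous_map_into_subtopology)
        show "continuous_map (top_of_set {0..1}) euclidean ?\<tau>"
          using continuous_on_subset[OF \<tau>(1), of "{0..1}"] by simp
        show "?\<tau> \<in> topspace (top_of_set {0..1}) \<rightarrow> {0..1}"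
          by (rule funcsetI, rule *) simp
      qed
      then show "continuous_map (top_of_set {0..1}) X (R' \<circ> ?\<tau>)"
        using R' unfolding pathin_def by (rule continuous_map_compose)
    qed (use P X eq in \<open>auto simp: pathin_def\<close>)
    with \<tau> show ?thesis by (intro exI[of _ ?\<tau>]) simp
  qed
  have "strict_mono_on {0<..<1} s \<or> strict_antimono_on {0<..<1} s"
    using injective_eq_monotone_map[of "{0<..<1}" s] cont inj by simp
  then show ?thesis
  proof
    assume "strict_mono_on {0<..<1} s"
    from main[OF R(1) this surj] s that show ?thesis by blast
  next
    assume anti: "strict_antimono_on {0<..<1} s"
    have "pathin X (R \<circ> (\<lambda>t. 1 - t))"
    proof -
      have "continuous_map (top_of_set {0..1}) (top_of_set {0..1}) (\<lambda>t::real. 1 - t)"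
        by (rule continuous_map_into_subtopology) (auto intro!: continuous_intros)
      from continuous_map_compose[OF this] R(1) show ?thesis unfolding pathin_def by blast
    qed
    moreover have "strict_mono_on {0<..<1} (\<lambda>t. 1 - s t)"
      using anti by (auto simp: monotone_on_def)
    moreover have "(\<lambda>t. 1 - s t) ` {0<..<1} = {0<..<1}"
    proof -
      have "(\<lambda>t. 1 - s t) ` {0<..<1} = (\<lambda>t. 1 - t) ` s ` {0<..<1}" by (simp add: image_image)
      also have "\<dots> = {0<..<1}"
        unfolding surj by (auto simp: image_iff intro!: bexI[of _ "1 - x" for x])
      finally show ?thesis .
    qed
    ultimately have "\<exists>\<tau>. continuous_on UNIV \<tau> \<and> strict_mono \<tau> \<and> \<tau> 0 = 0 \<and> \<tau> 1 = 1 \<and> (\<forall>t \<in> {0..1}. P t = (R \<circ> (\<lambda>t. 1 - t)) (\<tau> t))"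
      by (rule main) (use s in simp)
    with that show ?thesis by auto
  qed
qed

section \<open>Local degree and the model triangle\<close>

text \<open>Injectivity of \<open>\<phi>\<close> keeps the image of the loop away from the image of
  the centre. As the centre moves as well, it is subtracted, and the homotopy takes place in the
  punctured plane.\<close>

lemma winding_number_injective_homotopy:
  fixes \<phi> :: "complex \<Rightarrow> complex" and Z :: "real \<Rightarrow> real \<Rightarrow> complex"
  assumes \<phi>: "continuous_on W \<phi>" "inj_on \<phi> W"
    and Z: "continuous_on ({0..1} \<times> {0..1}) (\<lambda>(s, t). Z s t)" and C: "continuous_on {0..1} C"
    and W: "\<And>s t. s \<in> {0..1} \<Longrightarrow> t \<in> {0..1} \<Longrightarrow> Z s t \<in> W" "\<And>s. s \<in> {0..1} \<Longrightarrow> C s \<in> W"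
    and ne: "\<And>s t. s \<in> {0..1} \<Longrightarrow> t \<in> {0..1} \<Longrightarrow> Z s t \<noteq> C s"
    and loop: "\<And>s. s \<in> {0..1} \<Longrightarrow> Z s 0 = Z s 1"
  shows "winding_number (\<lambda>t. \<phi> (Z 0 t)) (\<phi> (C 0)) = winding_number (\<lambda>t. \<phi> (Z 1 t)) (\<phi> (C 1))"
proof -
  let ?h = "\<lambda>x. \<phi> (case x of (s, t) \<Rightarrow> Z s t) - \<phi> (C (fst x))"
  have "homotopic_loops (- {0}) (\<lambda>t. \<phi> (Z 0 t) - \<phi> (C 0)) (\<lambda>t. \<phi> (Z 1 t) - \<phi> (C 1))"
    unfolding homotopic_loops
  proof (intro exI[of _ ?h] conjI ballI)
    have "continuous_on ({0..1} \<times> {0..1}) (\<lambda>x. C (fst x))"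
      by (rule continuous_on_compose2[OF C]) (auto intro!: continuous_intros)
    then have "continuous_on ({0..1} \<times> {0..1}) (\<lambda>x. \<phi> (C (fst x)))"
      by (rule continuous_on_compose2[OF \<phi>(1)]) (use W in auto)
    moreover have "continuous_on ({0..1} \<times> {0..1}) (\<lambda>x. \<phi> (case x of (s, t) \<Rightarrow> Z s t))"
      by (rule continuous_on_compose2[OF \<phi>(1) Z]) (use W in auto)
    ultimately show "continuous_on ({0..1} \<times> {0..1}) ?h" by (intro continuous_on_diff)
    show "?h \<in> {0..1} \<times> {0..1} \<rightarrow> - {0}"
      using inj_onD[OF \<phi>(2)] W ne by fastforce
  qed (use loop in \<open>auto simp: pathstart_def pathfinish_def\<close>)
  then have "winding_number (\<lambda>t. \<phi> (Z 0 t) - \<phi> (C 0)) 0 = winding_number (\<lambda>t. \<phi> (Z 1 t) - \<phi> (C 1)) 0"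
    by (rule winding_number_homotopic_loops)
  then show ?thesis by (simp only: winding_number_offset[symmetric])
qed

text \<open>The definition speaks of circles that start at angle 0, while a circle drawn in the
  coordinates of a side starts at the angle of \<open>d\<close>. Conjugation runs through the circle
  backwards.\<close>

lemma preserves_orientation_circle:
  assumes "preserves_orientation W \<phi>" "continuous_on W \<phi>" "inj_on \<phi> W" "cball c (norm d) \<subseteq> W" "d \<noteq> 0"
  shows "winding_number (\<lambda>t. \<phi> (c + d * cis (2 * pi * t))) (\<phi> c) = 1"
    and "winding_number (\<lambda>t. \<phi> (c + d * cnj (cis (2 * pi * t)))) (\<phi> c) = - 1"
proof -
  have in_W: "c + d * w \<in> W" if "norm w = 1" for w :: complex
    using assms(4) that by (auto simp: dist_norm norm_mult)
  have in_W': "c + norm d * w \<in> W" if "norm w = 1" for w :: complex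
    using assms(4) that by (auto simp: dist_norm norm_mult)
  have "c \<in> W" using assms(4) by auto
  have d: "of_real (norm d) * cis (Arg d) = d" using rcis_cmod_Arg[of d] by (simp add: rcis_def)
  \<comment> \<open>Turns the starting point from angle 0 to \<open>Arg d\<close>.\<close>
  let ?Z = "\<lambda>s t. c + norm d * cis (Arg d * s + 2 * pi * t)"
  have "winding_number (\<lambda>t. \<phi> (?Z 0 t)) (\<phi> ((\<lambda>_. c) 0)) = winding_number (\<lambda>t. \<phi> (?Z 1 t)) (\<phi> ((\<lambda>_. c) 1))"
  proof (rule winding_number_injective_homotopy[OF assms(2,3), where C = "\<lambda>_. c"])
    show "continuous_on ({0..1} \<times> {0..1}) (\<lambda>(s, t). ?Z s t)"
      unfolding case_prod_unfold by (intro continuous_intros)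
    show "?Z s 0 = ?Z s 1" for s
      by (simp flip: cis_mult)
    show "?Z s t \<noteq> c" for s t
      using assms(5) by simp
  qed (use in_W' \<open>c \<in> W\<close> in auto)
  moreover have "(\<lambda>t. \<phi> (?Z 0 t)) = \<phi> \<circ> circlepath c (norm d)"
    by (auto simp: circlepath cis_conv_exp fun_eq_iff mult_ac)
  moreover have "?Z 1 t = c + d * cis (2 * pi * t)" for t
    using d by (simp flip: cis_mult mult.assoc)
  moreover have "winding_number (\<phi> \<circ> circlepath c (norm d)) (\<phi> c) = 1"
    using assms by (simp add: preserves_orientation_def)
  ultimately show 1: "winding_number (\<lambda>t. \<phi> (c + d * cis (2 * pi * t))) (\<phi> c) = 1" by simp
  let ?p = "\<lambda>t. \<phi> (c + d * cis (2 * pi * t))"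
  have "path ?p"
    unfolding path_def by (rule continuous_on_compose2[OF assms(2)]) (use in_W in \<open>auto intro!: continuous_intros\<close>)
  moreover have "\<phi> c \<notin> path_image ?p"
    using inj_onD[OF assms(3), of c "c + d * cis (2 * pi * t)" for t] in_W \<open>c \<in> W\<close> assms(5)
    by (auto simp: path_image_def)
  ultimately have "winding_number (reversepath ?p) (\<phi> c) = - 1"
    using winding_number_reversepath 1 by metis
  moreover have "cis (2 * pi * (1 - t)) = cnj (cis (2 * pi * t))" for t
  proof -
    have "cis (2 * pi * (1 - t)) = cis (2 * pi) * cis (- (2 * pi * t))"
      unfolding cis_mult by (simp add: algebra_simps)
    then show ?thesis by (simp add: cis_cnj)
  qed
  ultimately show "winding_number (\<lambda>t. \<phi> (c + d * cnj (cis (2 * pi * t)))) (\<phi> c) = - 1"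
    by (simp add: reversepath_def)
qed

section \<open>Coordinates in the model triangle\<close>

lemma sin_120: "sin (2 * pi / 3) = sqrt 3 / 2"
  using sin_120' by (simp add: mult.commute)

lemma cis_third: "cis (- (2 * pi / 3)) = Complex (- 1 / 2) (- sqrt 3 / 2)"
  by (simp add: complex_eq_iff cos_120 sin_120)

lemma model_corner_Suc: "model_corner (Suc n) = cis (- (2 * pi / 3)) * model_corner n"
proof -
  have "- 2 * pi * real (Suc n) / 3 = - (2 * pi / 3) + - 2 * pi * real n / 3"
    by (simp add: field_simps)
  then show ?thesis by (simp only: model_corner_def cis_mult)
qed

lemma model_corner_0: "model_corner 0 = 1"
  by (simp add: model_corner_def)

lemma model_corner_nonzero [simp]: "model_corner n \<noteq> 0"
  by (simp add: model_corner_def)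

text \<open>The three cube roots of unity add up to zero; the coordinate computations eliminate the
  third corner by this.\<close>

lemma model_corner_add2: "model_corner (n + 2) = - model_corner n - model_corner (n + 1)"
proof -
  have "cis (- (2 * pi / 3)) * cis (- (2 * pi / 3)) = - 1 - cis (- (2 * pi / 3))"
    unfolding cis_third by (simp add: complex_eq_iff)
  then have "cis (- (2 * pi / 3)) * cis (- (2 * pi / 3)) * model_corner n = (- 1 - cis (- (2 * pi / 3))) * model_corner n"
    by simp
  then show ?thesis by (simp add: model_corner_Suc algebra_simps)
qed

lemma model_corner_periodic: "model_corner (n + 3) = model_corner n"
  using model_corner_add2[of n] model_corner_add2[of "n + 1"] by (simp add: eval_nat_numeral)

lemma model_corner_set: "{model_corner n, model_corner (n + 1), model_corner (n + 2)} = model_corner ` {0, 1, 2}"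
proof (induction n)
  case (Suc n)
  then show ?case using model_corner_periodic[of n]
    by (auto simp: eval_nat_numeral)
qed (simp add: numeral_2_eq_2)

lemma model_triangle_eq: "model_triangle = convex hull {model_corner n, model_corner (n + 1), model_corner (n + 2)}"
  by (simp only: model_triangle_def model_corner_set)

lemma not_collinear_model_corners: "\<not> collinear {model_corner n, model_corner (n + 1), model_corner (n + 2)}"
proof -
  let ?\<omega> = "cis (- (2 * pi / 3))"
  have c: "model_corner 1 = ?\<omega>" using model_corner_Suc[of 0] by (simp add: model_corner_0)
  have c2: "model_corner 2 = - 1 - ?\<omega>" using model_corner_add2[of 0] c by (simp add: model_corner_0 numeral_2_eq_2)
  have "\<not> collinear {model_corner 0, model_corner 1, model_corner 2}"
    unfolding c c2 model_corner_0 cis_third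
    by (subst collinear_3) (auto simp: collinear_lemma complex_eq_iff)
  then show ?thesis unfolding model_corner_set by simp
qed

lemma in_model_triangle:
  assumes "x \<ge> 0" "y \<ge> 0" "z \<ge> 0" "x + y + z = 1"
  shows "of_real x * model_corner n + of_real y * model_corner (n + 1) + of_real z * model_corner (n + 2) \<in> model_triangle"
  unfolding model_triangle_eq[of n] convex_hull_3 using assms by (auto simp: scaleR_conv_of_real)

lemma in_interior_model_triangle:
  assumes "x > 0" "y > 0" "z > 0" "x + y + z = 1"
  shows "of_real x * model_corner n + of_real y * model_corner (n + 1) + of_real z * model_corner (n + 2) \<in> interior model_triangle"
  unfolding model_triangle_eq[of n]
  by (subst interior_convex_hull_3_minimal[OF not_collinear_model_corners])
    (use assms in \<open>auto simp: scaleR_conv_of_real\<close>)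

text \<open>The complex affine coordinate in which side \<open>n\<close> is the segment from 0 to 1.
  As the corners run clockwise, the triangle lies in the lower half plane. Being a similarity, it
  preserves orientation and maps circles to circles.\<close>

definition page :: "nat \<Rightarrow> complex \<Rightarrow> complex" where
  "page n w = model_corner n + (model_corner (n + 1) - model_corner n) * w"

lemma model_corner_distinct: "model_corner (n + 1) \<noteq> model_corner n"
proof
  assume "model_corner (n + 1) = model_corner n"
  then have "cis (- (2 * pi / 3)) = 1" by (simp add: model_corner_Suc)
  then show False by (simp add: cis_third complex_eq_iff)
qed

lemma page_inject [simp]: "page n w = page n w' \<longleftrightarrow> w = w'"
  using model_corner_distinct[of n] by (simp add: page_def)

lemma model_side_eq: "model_side n = (\<lambda>t. page n (of_real t)) ` {0<..<1}"
proof -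
  have "page n (of_real t) = (1 - t) *\<^sub>R model_corner n + t *\<^sub>R model_corner (n + 1)" for t
    by (simp add: page_def scaleR_conv_of_real algebra_simps)
  then show ?thesis
    using model_corner_distinct[of n] by (simp add: model_side_def open_segment_image_interval)
qed

lemma page_0 [simp]: "page n 0 = model_corner n" and page_1 [simp]: "page n 1 = model_corner (n + 1)"
  by (simp_all add: page_def)

text \<open>In this coordinate the side has length 1 and the height is \<open>sqrt 3 / 2\<close>, so
  a point at depth \<open>s\<close> has weight \<open>2 * s / sqrt 3\<close> at the third
  corner.\<close>

lemma page_barycentric:
  fixes s t :: real
  defines "z \<equiv> 2 * s / sqrt 3"
  shows "page n (Complex t (- s)) = of_real (1 - t - z / 2) * model_corner n + of_real (t - z / 2) * model_corner (n + 1) + of_real z * model_corner (n + 2)"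
proof -
  let ?\<omega> = "cis (- (2 * pi / 3))"
  have "(1 + (?\<omega> - 1) * Complex t (- s)) = of_real (1 - t - z / 2) + of_real (t - z / 2) * ?\<omega> + of_real z * (- 1 - ?\<omega>)"
    unfolding cis_third z_def by (simp add: complex_eq_iff field_simps)
  from arg_cong[OF this, of "\<lambda>x. x * model_corner n"] show ?thesis
    unfolding page_def model_corner_add2 by (simp add: model_corner_Suc algebra_simps)
qed

text \<open>The inequalities describe a triangle below the side with slopes 1, which is contained in
  the equilateral one with slopes \<open>sqrt 3\<close>.\<close>

lemma page_in_triangle:
  assumes "Im w \<le> 0" "- Im w < Re w" "- Im w < 1 - Re w"
  shows "page n w \<in> model_triangle" "Im w < 0 \<Longrightarrow> page n w \<in> interior model_triangle"
proof -
  define z where "z = 2 * (- Im w) / sqrt 3"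
  have "1 \<le> sqrt 3" by simp
  then have "(- Im w) / sqrt 3 \<le> - Im w" using assms(1) divide_left_mono[of 1 "sqrt 3" "- Im w"] by simp
  then have z: "z / 2 \<le> - Im w" by (simp add: z_def)
  have z0: "z \<ge> 0" "Im w < 0 \<Longrightarrow> z > 0" using assms(1) by (simp_all add: z_def divide_nonpos_pos divide_neg_pos)
  have eq: "page n w = of_real (1 - Re w - z / 2) * model_corner n + of_real (Re w - z / 2) * model_corner (n + 1) + of_real z * model_corner (n + 2)"
    using page_barycentric[of n "Re w" "- Im w"] by (simp add: z_def)
  show "page n w \<in> model_triangle" "Im w < 0 \<Longrightarrow> page n w \<in> interior model_triangle"
    unfolding eq by (rule in_model_triangle in_interior_model_triangle; use assms z z0 in simp)+
qed

text \<open>Affine coordinates with origin at the corner \<open>n + 1\<close> between the sides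
  \<open>n\<close> and \<open>n + 1\<close>: \<open>u\<close> measures along side \<open>n\<close>,
  \<open>v\<close> along side \<open>n + 1\<close>.\<close>

definition corner_sector :: "nat \<Rightarrow> real \<Rightarrow> real \<Rightarrow> complex" where
  "corner_sector n u v = of_real u * model_corner n + of_real (1 - u - v) * model_corner (n + 1) + of_real v * model_corner (n + 2)"

lemma corner_sector_in_triangle:
  "u \<ge> 0 \<Longrightarrow> v \<ge> 0 \<Longrightarrow> u + v \<le> 1 \<Longrightarrow> corner_sector n u v \<in> model_triangle"
  "u > 0 \<Longrightarrow> v > 0 \<Longrightarrow> u + v < 1 \<Longrightarrow> corner_sector n u v \<in> interior model_triangle"
  unfolding corner_sector_def by (rule in_model_triangle in_interior_model_triangle; simp)+

text \<open>Leaving the corner, side \<open>n\<close> is traversed backwards and side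
  \<open>n + 1\<close> forwards. This matches the direction reversal in the gluing of sides.\<close>

lemma corner_sector_sides:
  "corner_sector n u 0 = page n (of_real (1 - u))" "corner_sector n 0 v = page (n + 1) (of_real v)"
  by (simp_all add: corner_sector_def page_def algebra_simps)

lemma corner_sector_inject: "corner_sector n u v = corner_sector n u' v' \<longleftrightarrow> u = u' \<and> v = v'"
proof
  assume "corner_sector n u v = corner_sector n u' v'"
  moreover have "corner_sector n u v = Complex (3 * u / 2 - 1 / 2) (sqrt 3 * (u + 2 * v - 1) / 2) * model_corner n" for u v
  proof -
    have "of_real u + of_real (1 - u - v) * cis (- (2 * pi / 3)) + of_real v * (- 1 - cis (- (2 * pi / 3)))
      = Complex (3 * u / 2 - 1 / 2) (sqrt 3 * (u + 2 * v - 1) / 2)"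
      unfolding cis_third by (simp add: complex_eq_iff field_simps)
    from arg_cong[OF this, of "\<lambda>x. x * model_corner n"] show ?thesis
      unfolding corner_sector_def model_corner_add2 by (simp add: model_corner_Suc algebra_simps)
  qed
  ultimately show "u = u' \<and> v = v'" by simp
qed simp

text \<open>Side 1 lies on the line \<open>Re z = - 1 / 2\<close>; to the right of it, sides 0 and 2
  lie below and above the real axis.\<close>

lemma model_sides_disjoint:
  assumes "n < 3" "m < 3" "n \<noteq> m"
  shows "model_side n \<inter> model_side m = {}"
proof -
  let ?\<omega> = "cis (- (2 * pi / 3))"
  have c: "model_corner 1 = ?\<omega>" using model_corner_Suc[of 0] by (simp add: model_corner_0)
  have c2: "model_corner 2 = - 1 - ?\<omega>" using model_corner_add2[of 0] c by (simp add: model_corner_0 numeral_2_eq_2)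
  have c3: "model_corner 3 = 1" using model_corner_periodic[of 0] by (simp add: model_corner_0)
  have cs: "model_corner (0 + 1) = ?\<omega>" "model_corner (1 + 1) = - 1 - ?\<omega>" "model_corner (2 + 1) = 1"
    using c c2 c3 by (simp_all add: eval_nat_numeral)
  have 0: "Im z < 0 \<and> Re z > - 1 / 2" if "z \<in> model_side 0" for z
    using that unfolding model_side_eq page_def cs model_corner_0 cis_third by auto
  have 1: "Re z = - 1 / 2" if "z \<in> model_side 1" for z
    using that unfolding model_side_eq page_def cs c cis_third by auto
  have 2: "Im z > 0 \<and> Re z > - 1 / 2" if "z \<in> model_side 2" for z
    using that unfolding model_side_eq page_def cs c2 cis_third by (auto simp: field_simps)
  have "n = 0 \<or> n = 1 \<or> n = 2" "m = 0 \<or> m = 1 \<or> m = 2" using assms by auto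
  then show ?thesis using 0 1 2 assms(3) by fastforce
qed

section \<open>Gluing along an arc\<close>

lemma page_real_in_triangle: "t \<in> {0..1} \<Longrightarrow> page n (of_real t) \<in> model_triangle"
  using corner_sector_in_triangle(1)[of "1 - t" 0 n] by (simp add: corner_sector_sides)

text \<open>What the gluing arguments use of a triangle and one of its sides. Injectivity on the
  closed triangle may fail, so it is assumed on the interior and on the side separately, and the
  disjointness of \<open>U\<close>, \<open>C\<close> and \<open>M\<close> keeps these pieces
  apart.\<close>

definition has_side :: "'a topology \<Rightarrow> 'a set \<Rightarrow> 'a set \<Rightarrow> 'a set \<Rightarrow> (complex \<Rightarrow> 'a) \<Rightarrow> nat \<Rightarrow> bool" where
  "has_side X M U C f n \<longleftrightarrow>
     continuous_map (top_of_set model_triangle) X f \<and> inj_on f (interior model_triangle) \<and>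
     f ` interior model_triangle = U \<and> inj_on f (model_side n) \<and> f ` model_side n = C \<and>
     f (model_corner n) \<in> M \<and> f (model_corner (n + 1)) \<in> M \<and> U \<inter> C = {} \<and> C \<inter> M = {} \<and> U \<inter> M = {}"

lemma continuous_map_page:
  assumes "has_side X M U C f n" "continuous_on S p" "\<And>z. z \<in> S \<Longrightarrow> p z \<in> model_triangle"
  shows "continuous_map (top_of_set S) X (\<lambda>z. f (p z))"
proof -
  have "continuous_map (top_of_set S) (top_of_set model_triangle) p"
    using assms(2,3) by (intro continuous_map_into_subtopology) auto
  with assms(1) show ?thesis
    using continuous_map_compose[of "top_of_set S" "top_of_set model_triangle" p X f] by (simp add: has_side_def o_def)
qed

lemma has_side_inj:
  assumes "has_side X M U C f n"
  shows "inj_on f (interior model_triangle \<union> model_side n)"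
  using assms unfolding has_side_def by (subst inj_on_Un) blast

lemma side_reparametrization:
  assumes "Hausdorff_space X" and f: "has_side X M U C f n" and g: "has_side X M V C g m"
  obtains \<tau> where "continuous_on UNIV \<tau>" "strict_mono \<tau>" "\<tau> 0 = (0::real)" "\<tau> 1 = (1::real)"
    "(\<forall>t \<in> {0..1}. f (page n (of_real t)) = g (page m (of_real (\<tau> t)))) \<or>
     (\<forall>t \<in> {0..1}. f (page n (of_real t)) = g (page m (of_real (1 - \<tau> t))))"
proof (rule reparametrization[OF assms(1)])
  have path: "pathin X (\<lambda>t. f (page n (of_real t)))" if "has_side X M U C f n" for U f n
    unfolding pathin_def
    by (rule continuous_map_page[OF that _ page_real_in_triangle]) (auto intro!: continuous_intros simp: page_def)
  have inj: "inj_on (\<lambda>t. f (page n (of_real t))) {0<..<1}" if "has_side X M U C f n" for U f n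
    using that unfolding has_side_def model_side_eq by (auto simp: inj_on_def)
  have im: "(\<lambda>t. f (page n (of_real t))) ` {0<..<1} = C" if "has_side X M U C f n" for U f n
    using that unfolding has_side_def model_side_eq by (simp add: image_image)
  show "pathin X (\<lambda>t. f (page n (of_real t)))" "pathin X (\<lambda>t. g (page m (of_real t)))"
    "inj_on (\<lambda>t. f (page n (of_real t))) {0<..<1}" "inj_on (\<lambda>t. g (page m (of_real t))) {0<..<1}"
    using path inj f g by blast+
  show "(\<lambda>t. f (page n (of_real t))) ` {0<..<1} = (\<lambda>t. g (page m (of_real t))) ` {0<..<1}"
    using im f g by metis
  have "f (model_corner n) \<notin> C" "f (model_corner (n + 1)) \<notin> C"
      "g (model_corner m) \<notin> C" "g (model_corner (m + 1)) \<notin> C"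
    using f g unfolding has_side_def by blast+
  then show "f (page n (of_real 0)) \<notin> (\<lambda>t. f (page n (of_real t))) ` {0<..<1}"
    "f (page n (of_real 1)) \<notin> (\<lambda>t. f (page n (of_real t))) ` {0<..<1}"
    "g (page m (of_real 0)) \<notin> (\<lambda>t. f (page n (of_real t))) ` {0<..<1}"
    "g (page m (of_real 1)) \<notin> (\<lambda>t. f (page n (of_real t))) ` {0<..<1}"
    unfolding im[OF f] by simp_all
qed (rule that)

text \<open>Both triangles occupy the lower half plane of their pages, so the first one is reflected
  by \<open>cnj\<close> into the upper half disc. \<open>\<theta>\<close> makes the two halves agree
  on the real axis and may run in either direction. The two sides may also belong to a single
  triangle.\<close>

lemma edge_neighbourhood:
  fixes f g :: "complex \<Rightarrow> 'a" and \<theta> :: "real \<Rightarrow> real" and n m :: nat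
  defines "h \<equiv> \<lambda>t z. if 0 \<le> Im z then f (page n (of_real t + cnj z)) else g (page m (Complex (\<theta> (t + Re z)) (Im z)))"
  assumes f: "has_side X M U C f n" and g: "has_side X M V C g m"
    and \<theta>: "continuous_on UNIV \<theta>" "inj \<theta>" "\<And>t. t \<in> {0<..<1} \<Longrightarrow> \<theta> t \<in> {0<..<1}"
      "\<And>t. t \<in> {0<..<1} \<Longrightarrow> f (page n (of_real t)) = g (page m (of_real (\<theta> t)))"
    and disj: "U \<inter> V = {} \<or> f = g \<and> model_side n \<inter> model_side m = {}"
    and t: "t \<in> {0<..<1}" and e: "e > 0"
  obtains \<delta> where "\<delta> > 0" "continuous_map (top_of_set (ball 0 \<delta>)) X (h t)" "inj_on (h t) (ball 0 \<delta>)"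
    "\<And>z. z \<in> ball 0 \<delta> \<Longrightarrow> Im z > 0 \<Longrightarrow> page n (of_real t + cnj z) \<in> interior model_triangle \<inter> ball (page n (of_real t)) e"
    "\<And>z. z \<in> ball 0 \<delta> \<Longrightarrow> Im z < 0 \<Longrightarrow> page m (Complex (\<theta> (t + Re z)) (Im z)) \<in> interior model_triangle \<inter> ball (page m (of_real (\<theta> t))) e"
    "\<And>z. z \<in> ball 0 \<delta> \<Longrightarrow> t + Re z \<in> {0<..<1}"
proof -
  let ?F = "\<lambda>z. page n (of_real t + cnj z)" and ?G = "\<lambda>z. page m (Complex (\<theta> (t + Re z)) (Im z))"
  define p where "p = page n (of_real t)"
  define q where "q = page m (of_real (\<theta> t))"
  \<comment> \<open>Half the distance keeps the two half discs apart within one triangle. If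
    \<open>p = q\<close>, then \<open>disj\<close> says that the regions are disjoint.\<close>
  define e' where "e' = (if p = q then e else min e (dist p q / 2))"
  have e': "e' > 0" "e' \<le> e" "p \<noteq> q \<Longrightarrow> ball p e' \<inter> ball q e' = {}"
    using e by (auto simp: e'_def intro!: disjoint_ballI)
  have \<theta>': "continuous_on UNIV (\<lambda>z. \<theta> (t + Re z))"
    by (rule continuous_on_compose2[OF \<theta>(1)]) (auto intro!: continuous_intros)
  have cF: "continuous_on UNIV ?F" unfolding page_def by (intro continuous_intros)
  have cG: "continuous_on UNIV ?G" unfolding page_def by (intro continuous_intros \<theta>')
  \<comment> \<open>The inequalities of \<open>page_in_triangle\<close> for both pages, together
    with closeness to \<open>p\<close> and \<open>q\<close>; all of them are strict and hold at
    0.\<close>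
  define S where "S = {z. \<bar>Im z\<bar> < t + Re z} \<inter> {z. \<bar>Im z\<bar> < 1 - (t + Re z)} \<inter>
    {z. \<bar>Im z\<bar> < \<theta> (t + Re z)} \<inter> {z. \<bar>Im z\<bar> < 1 - \<theta> (t + Re z)} \<inter> {z. dist p (?F z) < e'} \<inter> {z. dist q (?G z) < e'}"
  have "open S" unfolding S_def
    by (intro open_Int open_Collect_less continuous_intros \<theta>' cF cG)
  moreover have "0 \<in> S" using t \<theta>(3)[OF t] e'(1) by (simp add: S_def p_def q_def Complex_eq)
  ultimately obtain \<delta> where \<delta>: "\<delta> > 0" "ball 0 \<delta> \<subseteq> S" using open_contains_ball by blast
  have Re: "t + Re z \<in> {0<..<1}" if "z \<in> ball 0 \<delta>" for z
    using that \<delta>(2) by (force simp: S_def)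
  have F: "?F z \<in> model_triangle" "?F z \<in> ball p e'" "Im z > 0 \<Longrightarrow> ?F z \<in> interior model_triangle"
      "Im z = 0 \<Longrightarrow> ?F z \<in> model_side n"
    if "z \<in> ball 0 \<delta>" "Im z \<ge> 0" for z
  proof -
    have z: "z \<in> S" using that \<delta>(2) by blast
    then show "?F z \<in> model_triangle" "Im z > 0 \<Longrightarrow> ?F z \<in> interior model_triangle"
      using page_in_triangle[of "of_real t + cnj z" n] that(2) by (auto simp: S_def)
    show "?F z \<in> ball p e'" using z by (simp add: S_def)
    show "?F z \<in> model_side n" if "Im z = 0"
    proof -
      have "of_real t + cnj z = of_real (t + Re z)" using that by (simp add: complex_eq_iff)
      then show ?thesis using Re[OF \<open>z \<in> ball 0 \<delta>\<close>] unfolding model_side_eq by (metis imageI)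
    qed
  qed
  have G: "?G z \<in> model_triangle" "?G z \<in> ball q e'" "Im z < 0 \<Longrightarrow> ?G z \<in> interior model_triangle"
      "Im z = 0 \<Longrightarrow> ?G z \<in> model_side m"
    if "z \<in> ball 0 \<delta>" "Im z \<le> 0" for z
  proof -
    have z: "z \<in> S" using that \<delta>(2) by blast
    then show "?G z \<in> model_triangle" "Im z < 0 \<Longrightarrow> ?G z \<in> interior model_triangle"
      using page_in_triangle[of "Complex (\<theta> (t + Re z)) (Im z)" m] that(2) by (auto simp: S_def)
    show "?G z \<in> ball q e'" using z by (simp add: S_def)
    show "?G z \<in> model_side m" if "Im z = 0"
    proof -
      have "Complex (\<theta> (t + Re z)) (Im z) = of_real (\<theta> (t + Re z))" using that by (simp add: complex_eq_iff)
      then show ?thesis using \<theta>(3)[OF Re[OF \<open>z \<in> ball 0 \<delta>\<close>]] by (auto simp: model_side_eq)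
    qed
  qed
  have gl1: "continuous_map (top_of_set (ball 0 \<delta> \<inter> {z. 0 \<le> Im z})) X (\<lambda>z. f (?F z))"
    using F by (intro continuous_map_page[OF f] continuous_on_subset[OF cF]) auto
  have gl3: "continuous_map (top_of_set (ball 0 \<delta> \<inter> {z. Im z \<le> 0})) X (\<lambda>z. g (?G z))"
    using G by (intro continuous_map_page[OF g] continuous_on_subset[OF cG]) auto
  have gl2: "inj_on (\<lambda>z. f (?F z)) (ball 0 \<delta> \<inter> {z. 0 \<le> Im z})"
  proof (rule inj_onI)
    fix z w assume zw: "z \<in> ball 0 \<delta> \<inter> {z. 0 \<le> Im z}" "w \<in> ball 0 \<delta> \<inter> {z. 0 \<le> Im z}" "f (?F z) = f (?F w)"
    then have "?F z \<in> interior model_triangle \<union> model_side n" "?F w \<in> interior model_triangle \<union> model_side n"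
      using F[of z] F[of w] by fastforce+
    with zw(3) have "?F z = ?F w" using inj_onD[OF has_side_inj[OF f]] by blast
    then show "z = w" by simp
  qed
  have gl4: "inj_on (\<lambda>z. g (?G z)) (ball 0 \<delta> \<inter> {z. Im z \<le> 0})"
  proof (rule inj_onI)
    fix z w assume zw: "z \<in> ball 0 \<delta> \<inter> {z. Im z \<le> 0}" "w \<in> ball 0 \<delta> \<inter> {z. Im z \<le> 0}" "g (?G z) = g (?G w)"
    then have "?G z \<in> interior model_triangle \<union> model_side m" "?G w \<in> interior model_triangle \<union> model_side m"
      using G[of z] G[of w] by fastforce+
    with zw(3) have "?G z = ?G w" using inj_onD[OF has_side_inj[OF g]] by blast
    then have "\<theta> (t + Re z) = \<theta> (t + Re w)" "Im z = Im w" by simp_all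
    then show "z = w" using injD[OF \<theta>(2), of "t + Re z" "t + Re w"] by (simp add: complex_eq_iff)
  qed
  have gl5: "f (?F z) = g (?G z)" if "z \<in> ball 0 \<delta>" "Im z = 0" for z
  proof -
    have "of_real t + cnj z = of_real (t + Re z)" "Complex (\<theta> (t + Re z)) (Im z) = of_real (\<theta> (t + Re z))"
      using that by (simp_all add: complex_eq_iff)
    then show ?thesis using \<theta>(4)[OF Re[OF that(1)]] by simp
  qed
  have gl6: "f (?F z) \<noteq> g (?G w)" if zw: "z \<in> ball 0 \<delta>" "w \<in> ball 0 \<delta>" "Im z > 0" "Im w < 0" for z w
  proof
    assume eq: "f (?F z) = g (?G w)"
    have i: "?F z \<in> interior model_triangle" "?G w \<in> interior model_triangle" using F G zw by simp_all
    moreover have "f ` interior model_triangle = U" "g ` interior model_triangle = V"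
      using f g by (simp_all add: has_side_def)
    ultimately have "f (?F z) \<in> U" "g (?G w) \<in> V" by (metis imageI)+
    with eq have "U \<inter> V \<noteq> {}" by auto
    with disj have fg: "f = g" "model_side n \<inter> model_side m = {}" by blast+
    moreover have "inj_on f (interior model_triangle)" using f by (simp add: has_side_def)
    ultimately have "?F z = ?G w" using eq i inj_onD by metis
    moreover have "p \<in> model_side n" "q \<in> model_side m"
      using t \<theta>(3)[OF t] by (auto simp: p_def q_def model_side_eq)
    then have "p \<noteq> q" using fg(2) by auto
    moreover have "?F z \<in> ball p e'" "?G w \<in> ball q e'" using F(2) G(2) zw by simp_all
    ultimately show False using e'(3) by auto
  qed
  have gl: "continuous_map (top_of_set (ball 0 \<delta>)) X (h t)" "inj_on (h t) (ball 0 \<delta>)"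
    unfolding h_def by (rule glue_half_discs[OF gl1 gl2 gl3 gl4 gl5 gl6]; assumption)+
  show ?thesis
  proof (rule that[OF \<delta>(1) gl])
    show "?F z \<in> interior model_triangle \<inter> ball (page n (of_real t)) e" if "z \<in> ball 0 \<delta>" "Im z > 0" for z
      using F[of z] that e'(2) by (auto simp: p_def)
    show "?G z \<in> interior model_triangle \<inter> ball (page m (of_real (\<theta> t))) e" if "z \<in> ball 0 \<delta>" "Im z < 0" for z
      using G[of z] that e'(2) by (auto simp: q_def)
  qed (rule Re)
qed

text \<open>A point of the third triangle close to the arc lies in the neighbourhood glued from the
  other two, hence on \<open>C\<close> or in \<open>U\<close> or \<open>V\<close>. The first
  contradicts disjointness of \<open>W\<close> and \<open>C\<close>; the others are possible only
  inside one and the same triangle.\<close>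

lemma no_three_sides:
  assumes X: "surface X"
    and f: "has_side X M U C f n" and g: "has_side X M V C g m" and e: "has_side X M W C e l"
    and "U \<inter> V = {} \<or> f = g \<and> model_side n \<inter> model_side m = {}"
    and UW: "U \<inter> W = {} \<or> f = e \<and> model_side n \<inter> model_side l = {}"
    and VW: "V \<inter> W = {} \<or> g = e \<and> model_side m \<inter> model_side l = {}"
  shows False
proof -
  obtain \<theta> where \<theta>: "continuous_on UNIV \<theta>" "inj \<theta>" "\<And>t. t \<in> {0<..<1} \<Longrightarrow> \<theta> t \<in> {0<..<1::real}"
      "\<And>t. t \<in> {0<..<1} \<Longrightarrow> f (page n (of_real t)) = g (page m (of_real (\<theta> t)))"
  proof -
    have "Hausdorff_space X" using X by (simp add: surface_def)
    from side_reparametrization[OF this f g] obtain \<tau> where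
      \<tau>: "continuous_on UNIV \<tau>" "strict_mono \<tau>" "\<tau> 0 = (0::real)" "\<tau> 1 = (1::real)"
      "(\<forall>t \<in> {0..1}. f (page n (of_real t)) = g (page m (of_real (\<tau> t)))) \<or>
       (\<forall>t \<in> {0..1}. f (page n (of_real t)) = g (page m (of_real (1 - \<tau> t))))" by blast
    have r: "0 < \<tau> t \<and> \<tau> t < 1" if "t \<in> {0<..<1}" for t
      using strict_monoD[OF \<tau>(2), of 0 t] strict_monoD[OF \<tau>(2), of t 1] \<tau>(3,4) that by auto
    have inj: "inj \<tau>" using \<tau>(2) strict_mono_imp_inj_on by blast
    from \<tau>(5) show ?thesis
    proof
      assume "\<forall>t \<in> {0..1}. f (page n (of_real t)) = g (page m (of_real (\<tau> t)))"
      then show ?thesis using that[of \<tau>] \<tau>(1) inj r by simp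
    next
      assume "\<forall>t \<in> {0..1}. f (page n (of_real t)) = g (page m (of_real (1 - \<tau> t)))"
      moreover have "continuous_on UNIV (\<lambda>t. 1 - \<tau> t)" by (intro continuous_intros \<tau>(1))
      ultimately show ?thesis using that[of "\<lambda>t. 1 - \<tau> t"] inj r
        by (auto simp: inj_def)
    qed
  qed
  define t :: real where "t = 1 / 2"
  have t: "t \<in> {0<..<1}" by (simp add: t_def)
  define p where "p = page n (of_real t)"
  define q where "q = page m (of_real (\<theta> t))"
  have "p \<in> model_side n" "q \<in> model_side m" using t \<theta>(3)[OF t] by (auto simp: p_def q_def model_side_eq)
  then have "f p \<in> C" using f by (auto simp: has_side_def)
  then obtain r where r: "r \<in> model_side l" "e r = f p" using e by (auto simp: has_side_def)
  \<comment> \<open>If the third side shares its triangle with one of the others, separate balls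
    around their points rule out that the nearby interior points coincide.\<close>
  define \<epsilon> where "\<epsilon> = min (if p = r then 1 else dist p r / 2) (if q = r then 1 else dist q r / 2)"
  have \<epsilon>: "\<epsilon> > 0" by (simp add: \<epsilon>_def)
  have p: "ball p \<epsilon> \<inter> ball r \<epsilon> = {}" if "p \<noteq> r" by (rule disjoint_ballI) (use that in \<open>simp add: \<epsilon>_def\<close>)
  have q: "ball q \<epsilon> \<inter> ball r \<epsilon> = {}" if "q \<noteq> r" by (rule disjoint_ballI) (use that in \<open>simp add: \<epsilon>_def\<close>)
  let ?h = "\<lambda>z. if 0 \<le> Im z then f (page n (of_real t + cnj z)) else g (page m (Complex (\<theta> (t + Re z)) (Im z)))"
  obtain \<delta> where \<delta>: "\<delta> > 0" "continuous_map (top_of_set (ball 0 \<delta>)) X ?h" "inj_on ?h (ball 0 \<delta>)"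
    "\<And>z. z \<in> ball 0 \<delta> \<Longrightarrow> Im z > 0 \<Longrightarrow> page n (of_real t + cnj z) \<in> interior model_triangle \<inter> ball p \<epsilon>"
    "\<And>z. z \<in> ball 0 \<delta> \<Longrightarrow> Im z < 0 \<Longrightarrow> page m (Complex (\<theta> (t + Re z)) (Im z)) \<in> interior model_triangle \<inter> ball q \<epsilon>"
    "\<And>z. z \<in> ball 0 \<delta> \<Longrightarrow> t + Re z \<in> {0<..<1}"
    using edge_neighbourhood[OF f g \<theta> assms(5) t \<epsilon>] unfolding p_def q_def by blast
  have N: "openin X (?h ` ball 0 \<delta>)" by (rule open_image[OF X open_ball \<delta>(2,3)])
  have "?h 0 = f p" by (simp add: p_def)
  then have "e r = ?h 0" using r(2) by simp
  then have "e r \<in> ?h ` ball 0 \<delta>" by (rule image_eqI) (use \<delta>(1) in simp)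
  moreover have "openin (top_of_set model_triangle) {w \<in> topspace (top_of_set model_triangle). e w \<in> ?h ` ball 0 \<delta>}"
    by (rule openin_continuous_map_preimage[OF _ N]) (use e in \<open>simp add: has_side_def\<close>)
  moreover obtain s where s: "s \<in> {0<..<1}" "r = page l (of_real s)" using r(1) by (auto simp: model_side_eq)
  moreover have "r \<in> model_triangle" using page_real_in_triangle[of s l] s by simp
  ultimately obtain \<eta> where \<eta>: "\<eta> > 0" "\<And>w. w \<in> model_triangle \<Longrightarrow> dist w r < \<eta> \<Longrightarrow> e w \<in> ?h ` ball 0 \<delta>"
    unfolding openin_euclidean_subtopology_iff by auto
  \<comment> \<open>Moves from \<open>r\<close> straight into the third triangle.\<close>
  let ?k = "\<lambda>y. page l (Complex s (- y))"
  have "continuous_on UNIV ?k" unfolding page_def by (intro continuous_intros)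
  then have "open ({y. y < s} \<inter> {y. y < 1 - s} \<inter> {y. dist r (?k y) < min \<epsilon> \<eta>})"
    by (intro open_Int open_Collect_less continuous_intros)
  moreover have "0 \<in> {y. y < s} \<inter> {y. y < 1 - s} \<inter> {y. dist r (?k y) < min \<epsilon> \<eta>}"
    using s \<epsilon> \<eta>(1) by (simp add: Complex_eq)
  ultimately obtain \<rho> where \<rho>: "\<rho> > 0" "ball 0 \<rho> \<subseteq> {y. y < s} \<inter> {y. y < 1 - s} \<inter> {y. dist r (?k y) < min \<epsilon> \<eta>}"
    using open_contains_ball by blast
  have "\<rho> / 2 \<in> ball 0 \<rho>" using \<rho>(1) by (simp add: dist_norm)
  then have "\<rho> / 2 \<in> {y. y < s} \<inter> {y. y < 1 - s} \<inter> {y. dist r (?k y) < min \<epsilon> \<eta>}" using \<rho>(2) by blast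
  then have y: "\<rho> / 2 < s" "\<rho> / 2 < 1 - s" "dist r (?k (\<rho> / 2)) < \<epsilon>" "dist r (?k (\<rho> / 2)) < \<eta>" by auto
  define w where "w = ?k (\<rho> / 2)"
  have w: "w \<in> interior model_triangle" "w \<in> ball r \<epsilon>"
    using page_in_triangle(2)[of "Complex s (- (\<rho> / 2))" l] y \<rho>(1) by (simp_all add: w_def)
  then have "e w \<in> ?h ` ball 0 \<delta>" using \<eta>(2)[of w] y(4) interior_subset by (auto simp: w_def dist_commute)
  then obtain z where z: "z \<in> ball 0 \<delta>" "e w = ?h z" by blast
  have eW: "e w \<in> W" using w(1) e by (auto simp: has_side_def)
  consider "Im z = 0" | "Im z > 0" | "Im z < 0" by linarith
  then show False
  proof cases
    case 1
    then have "of_real t + cnj z = of_real (t + Re z)" by (simp add: complex_eq_iff)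
    then have "page n (of_real t + cnj z) \<in> model_side n"
      unfolding model_side_eq using \<delta>(6)[OF z(1)] by (metis imageI)
    then have "?h z \<in> f ` model_side n" using 1 by simp
    then have "?h z \<in> C" using f unfolding has_side_def by blast
    with z(2) eW have "W \<inter> C \<noteq> {}" by auto
    then show False using e by (simp add: has_side_def)
  next
    case 2
    let ?p = "page n (of_real t + cnj z)"
    have i: "?p \<in> interior model_triangle" "?p \<in> ball p \<epsilon>" using \<delta>(4)[OF z(1) 2] by auto
    have eq: "e w = f ?p" using z(2) 2 by simp
    moreover have "f ?p \<in> U" using i f unfolding has_side_def by blast
    ultimately have fe: "f = e" "model_side n \<inter> model_side l = {}" using UW eW by auto
    then have "w = ?p" using eq w(1) i(1) e unfolding has_side_def by (metis inj_onD)
    moreover have "p \<noteq> r" using fe(2) \<open>p \<in> model_side n\<close> r(1) by auto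
    ultimately show False using p i w(2) by auto
  next
    case 3
    let ?q = "page m (Complex (\<theta> (t + Re z)) (Im z))"
    have i: "?q \<in> interior model_triangle" "?q \<in> ball q \<epsilon>" using \<delta>(5)[OF z(1) 3] by auto
    have eq: "e w = g ?q" using z(2) 3 by simp
    moreover have "g ?q \<in> V" using i g unfolding has_side_def by blast
    ultimately have fe: "g = e" "model_side m \<inter> model_side l = {}" using VW eW by auto
    then have "w = ?q" using eq w(1) i(1) e unfolding has_side_def by (metis inj_onD)
    moreover have "q \<noteq> r" using fe(2) \<open>q \<in> model_side m\<close> r(1) by auto
    ultimately show False using q i w(2) by auto
  qed
qed

lemma page_circle: "page n (a + b * w) = page n a + ((model_corner (n + 1) - model_corner n) * b) * w"
  by (simp add: page_def algebra_simps)

lemma page_affine: "page n (of_real (1 - s) * w + of_real s * w') = (1 - s) *\<^sub>R page n w + s *\<^sub>R page n w'"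
  by (simp add: page_def scaleR_conv_of_real algebra_simps)

lemma page_cball:
  assumes "w \<in> cball (page n a) (norm ((model_corner (n + 1) - model_corner n) * of_real r))" "r > 0"
  obtains z where "w = page n z" "dist a z \<le> r"
proof (rule that)
  let ?d = "model_corner (n + 1) - model_corner n"
  have d: "?d \<noteq> 0" using model_corner_distinct[of n] by simp
  show w: "w = page n ((w - model_corner n) / ?d)" using d by (simp add: page_def)
  have "page n a - w = ?d * (a - (w - model_corner n) / ?d)"
    using d by (simp add: page_def field_simps)
  moreover have "norm (page n a - w) \<le> norm ?d * r"
    using assms by (simp add: dist_norm norm_mult)
  ultimately show "dist a ((w - model_corner n) / ?d) \<le> r"
    using d unfolding dist_norm by (simp add: norm_mult)
qed

text \<open>With an increasing \<open>\<theta>\<close> the glued disc contains one page reflected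
  and the other one not. A small circle carried across the arc keeps its winding number, since the
  glued map is injective, yet the number is -1 on the reflected side and 1 on the other.\<close>

lemma gluing_reverses_orientation:
  assumes X: "oriented_atlas X A"
    and f: "has_side X M U C f n" and g: "has_side X M V C g m" and UV: "U \<inter> V = {}"
    and of: "orientation_preserving_triangle A f" and og: "orientation_preserving_triangle A g"
    and \<theta>: "continuous_on UNIV \<theta>" "strict_mono \<theta>" "\<And>t. t \<in> {0<..<1} \<Longrightarrow> \<theta> t \<in> {0<..<1::real}"
      "\<And>t. t \<in> {0<..<1} \<Longrightarrow> f (page n (of_real t)) = g (page m (of_real (\<theta> t)))"
  shows False
proof -
  define t :: real where "t = 1 / 2"
  have t: "t \<in> {0<..<1}" by (simp add: t_def)
  define p where "p = page n (of_real t)"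
  define q where "q = page m (of_real (\<theta> t))"
  have pq: "p \<in> model_triangle" "q \<in> model_triangle"
    using page_real_in_triangle[of t n] page_real_in_triangle[of "\<theta> t" m] t \<theta>(3)[OF t] by (simp_all add: p_def q_def)
  have fp: "f p = g q" using \<theta>(4)[OF t] by (simp add: p_def q_def)
  have cont: "continuous_map (top_of_set model_triangle) X f" "continuous_map (top_of_set model_triangle) X g"
    using f g by (simp_all add: has_side_def)
  then have "f p \<in> topspace X" using pq by (auto simp: continuous_map_def)
  then obtain V0 \<phi> where A: "(V0, \<phi>) \<in> A" and V0: "f p \<in> V0" using X by (auto simp: oriented_atlas_def)
  have chart: "chart X V0 \<phi>" using X A by (auto simp: oriented_atlas_def)
  then have V0_open: "openin X V0" by (simp add: chart_def)
  define Wf where "Wf = {z \<in> interior model_triangle. f z \<in> V0}"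
  define Wg where "Wg = {z \<in> interior model_triangle. g z \<in> V0}"
  have po: "preserves_orientation Wf (\<phi> \<circ> f)" "preserves_orientation Wg (\<phi> \<circ> g)"
    using of og A unfolding orientation_preserving_triangle_def Wf_def Wg_def by auto
  have int: "continuous_map (top_of_set (interior model_triangle)) X f" "continuous_map (top_of_set (interior model_triangle)) X g"
    using cont interior_subset by (meson continuous_map_from_subtopology_mono)+
  have inj: "inj_on f (interior model_triangle)" "inj_on g (interior model_triangle)"
    using f g by (simp_all add: has_side_def)
  note Wf = chart_compose[OF chart open_interior int(1) inj(1), folded Wf_def]
  note Wg = chart_compose[OF chart open_interior int(2) inj(2), folded Wg_def]
  have "openin (top_of_set model_triangle) {w \<in> topspace (top_of_set model_triangle). g w \<in> V0}"
    by (rule openin_continuous_map_preimage[OF cont(2) V0_open])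
  then obtain \<eta> where \<eta>: "\<eta> > 0" "\<And>w. w \<in> model_triangle \<Longrightarrow> dist w q < \<eta> \<Longrightarrow> g w \<in> V0"
    unfolding openin_euclidean_subtopology_iff using pq(2) V0 fp by (auto 0 3)
  \<comment> \<open>Used for the straight-line homotopy that removes the distortion by
    \<open>\<theta>\<close>: it stays where \<open>g\<close> maps into the chart domain.\<close>
  have convex: "convex (interior model_triangle \<inter> ball q \<eta>)"
    by (intro convex_Int convex_interior) (auto simp: model_triangle_def)
  have in_Wg: "w \<in> Wg" if "w \<in> interior model_triangle \<inter> ball q \<eta>" for w
    using that \<eta>(2)[of w] interior_subset by (auto simp: Wg_def dist_commute)
  let ?G = "\<lambda>z. page m (Complex (\<theta> (t + Re z)) (Im z))"
  let ?h = "\<lambda>z. if 0 \<le> Im z then f (page n (of_real t + cnj z)) else g (?G z)"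
  have "U \<inter> V = {} \<or> f = g \<and> model_side n \<inter> model_side m = {}" using UV by blast
  from edge_neighbourhood[OF f g \<theta>(1) strict_mono_imp_inj_on[OF \<theta>(2)] \<theta>(3,4) this t \<eta>(1)]
  obtain \<delta> where \<delta>: "\<delta> > 0" "continuous_map (top_of_set (ball 0 \<delta>)) X ?h" "inj_on ?h (ball 0 \<delta>)"
    "\<And>z. z \<in> ball 0 \<delta> \<Longrightarrow> Im z > 0 \<Longrightarrow> page n (of_real t + cnj z) \<in> interior model_triangle \<inter> ball p \<eta>"
    "\<And>z. z \<in> ball 0 \<delta> \<Longrightarrow> Im z < 0 \<Longrightarrow> ?G z \<in> interior model_triangle \<inter> ball q \<eta>"
    "\<And>z. z \<in> ball 0 \<delta> \<Longrightarrow> t + Re z \<in> {0<..<1}"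
    unfolding p_def q_def by blast
  note H = chart_compose[OF chart open_ball \<delta>(2,3)]
  let ?L = "\<lambda>z. page m (of_real (\<theta> t) + z)"
  have cL: "continuous_on UNIV ?L" unfolding page_def by (intro continuous_intros)
  define S where "S = {z \<in> ball 0 \<delta>. ?h z \<in> V0} \<inter> {z. \<bar>Im z\<bar> < \<theta> t + Re z} \<inter> {z. \<bar>Im z\<bar> < 1 - (\<theta> t + Re z)} \<inter> {z. dist q (?L z) < \<eta>}"
  have "open S" unfolding S_def
    by (intro open_Int open_Collect_less continuous_intros cL H(1))
  moreover have "0 \<in> S" using \<delta>(1) V0 \<theta>(3)[OF t] \<eta>(1) by (simp add: S_def p_def q_def)
  ultimately obtain \<rho>' where \<rho>': "\<rho>' > 0" "ball 0 \<rho>' \<subseteq> S" using open_contains_ball by blast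
  define \<rho> where "\<rho> = \<rho>' / 2"
  \<comment> \<open>Centres at height \<open>\<rho>\<close> and radius \<open>\<rho> / 2\<close>
    keep the circle off the real axis at both ends of its way, and everything stays within distance
    \<open>2 * \<rho>\<close> of 0.\<close>
  define r where "r = \<rho> / 2"
  have \<rho>: "\<rho> > 0" "r > 0" "r < \<rho>" using \<rho>'(1) by (simp_all add: \<rho>_def r_def)
  have S: "z \<in> ball 0 \<delta>" "?h z \<in> V0" "Im z < 0 \<Longrightarrow> ?L z \<in> interior model_triangle \<inter> ball q \<eta>" if "norm z < 2 * \<rho>" for z
  proof -
    have "z \<in> ball 0 \<rho>'" using that by (simp add: \<rho>_def)
    then have z: "z \<in> S" using \<rho>'(2) by blast
    then show "z \<in> ball 0 \<delta>" "?h z \<in> V0" by (simp_all add: S_def)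
    show "?L z \<in> interior model_triangle \<inter> ball q \<eta>" if "Im z < 0"
      using z that page_in_triangle(2)[of "of_real (\<theta> t) + z" m] by (simp add: S_def)
  qed
  have norm_less: "norm z < 2 * \<rho>" if "norm (z - c) \<le> r" "norm c \<le> \<rho>" for z c
    using norm_triangle_ineq[of "z - c" c] that \<rho> by simp
  define a where "a = \<i> * of_real \<rho>"
  have a: "norm a = \<rho>" "norm (- a) = \<rho>" "Re a = 0" "Im a = \<rho>" using \<rho> by (simp_all add: a_def norm_mult)
  have Im_pos: "Im z > 0" if "norm (z - a) \<le> r" for z
    using that abs_Im_le_cmod[of "z - a"] \<rho> a by simp
  have Im_neg: "Im z < 0" if "norm (z + a) \<le> r" for z
    using that abs_Im_le_cmod[of "z + a"] \<rho> a by simp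
  let ?c = "\<lambda>\<tau>. of_real r * cis (2 * pi * \<tau>)"
  have norm_c: "norm (?c \<tau>) = r" for \<tau> using \<rho> by (simp add: norm_mult)

  let ?D = "{z \<in> ball 0 \<delta>. ?h z \<in> V0}"
  \<comment> \<open>The centre travels straight from \<open>a\<close> to \<open>- a\<close>, so that
    the circle crosses the arc.\<close>
  let ?C = "\<lambda>s. of_real (1 - 2 * s) * a"
  have C: "norm (?C s) \<le> \<rho>" if "s \<in> {0..1}" for s
  proof -
    have "\<bar>1 - 2 * s\<bar> \<le> 1" using that by auto
    then have "\<bar>1 - 2 * s\<bar> * \<rho> \<le> 1 * \<rho>" using \<rho> by (intro mult_right_mono) auto
    then show ?thesis by (simp only: norm_mult norm_of_real a(1) mult_1)
  qed
  have "winding_number (\<lambda>\<tau>. (\<phi> \<circ> ?h) (?C 0 + ?c \<tau>)) ((\<phi> \<circ> ?h) (?C 0)) = winding_number (\<lambda>\<tau>. (\<phi> \<circ> ?h) (?C 1 + ?c \<tau>)) ((\<phi> \<circ> ?h) (?C 1))"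
  proof (rule winding_number_injective_homotopy[OF H(2,3)])
    show "continuous_on ({0..1} \<times> {0..1}) (\<lambda>(s, \<tau>). ?C s + ?c \<tau>)"
      unfolding case_prod_unfold by (intro continuous_intros)
    show "continuous_on {0..1} ?C" by (intro continuous_intros)
    show "?C s + ?c \<tau> \<in> ?D" if "s \<in> {0..1}" "\<tau> \<in> {0..1}" for s \<tau>
      using S[of "?C s + ?c \<tau>"] norm_less[of "?C s + ?c \<tau>" "?C s"] C[OF that(1)] norm_c[of \<tau>] by auto
    show "?C s \<in> ?D" if "s \<in> {0..1}" for s
      using S[of "?C s"] C[OF that(1)] \<rho> by auto
    show "?C s + ?c \<tau> \<noteq> ?C s" for s \<tau> using norm_c[of \<tau>] \<rho> by auto
    show "?C s + ?c 0 = ?C s + ?c 1" for s by simp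
  qed
  moreover have "winding_number (\<lambda>\<tau>. (\<phi> \<circ> ?h) (?C 0 + ?c \<tau>)) ((\<phi> \<circ> ?h) (?C 0)) = - 1"
  proof -
    let ?d = "(model_corner (n + 1) - model_corner n) * of_real r"
    have "cball (page n (of_real t + cnj a)) (norm ?d) \<subseteq> Wf"
    proof
      fix w assume "w \<in> cball (page n (of_real t + cnj a)) (norm ?d)"
      then obtain z where z: "w = page n z" "dist (of_real t + cnj a) z \<le> r" using page_cball \<rho>(2) by blast
      define y where "y = cnj (z - of_real t)"
      have wy: "w = page n (of_real t + cnj y)" by (simp add: z y_def)
      have "norm (cnj (y - a)) \<le> r" using z(2) by (simp add: y_def dist_norm norm_minus_commute algebra_simps)
      then have y: "norm (y - a) \<le> r" by (simp only: complex_mod_cnj)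
      have y': "norm y < 2 * \<rho>" using norm_less[OF y] a by simp
      show "w \<in> Wf"
        using S(1,2)[OF y'] Im_pos[OF y] \<delta>(4)[of y] by (simp add: Wf_def wy)
    qed
    moreover have "?d \<noteq> 0" using model_corner_distinct[of n] \<rho> by simp
    ultimately have "winding_number (\<lambda>\<tau>. (\<phi> \<circ> f) (page n (of_real t + cnj a) + ?d * cnj (cis (2 * pi * \<tau>)))) ((\<phi> \<circ> f) (page n (of_real t + cnj a))) = - 1"
      by (rule preserves_orientation_circle(2)[OF po(1) Wf(2,3)])
    moreover have "(\<phi> \<circ> ?h) (?C 0 + ?c \<tau>) = (\<phi> \<circ> f) (page n (of_real t + cnj a) + ?d * cnj (cis (2 * pi * \<tau>)))" for \<tau>
    proof -
      have "Im (a + ?c \<tau>) > 0" by (rule Im_pos) (use norm_c[of \<tau>] in simp)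
      moreover have "page n (of_real t + cnj (a + ?c \<tau>)) = page n (of_real t + cnj a) + ?d * cnj (cis (2 * pi * \<tau>))"
        unfolding page_circle[symmetric] by (simp add: algebra_simps)
      ultimately show ?thesis by simp
    qed
    moreover have "(\<phi> \<circ> ?h) (?C 0) = (\<phi> \<circ> f) (page n (of_real t + cnj a))" using a \<rho> by simp
    ultimately show ?thesis by presburger
  qed
  moreover have "winding_number (\<lambda>\<tau>. (\<phi> \<circ> ?h) (?C 1 + ?c \<tau>)) ((\<phi> \<circ> ?h) (?C 1)) = 1"
  proof -
    let ?d = "(model_corner (m + 1) - model_corner m) * of_real r"
    let ?z = "\<lambda>\<tau>. - a + ?c \<tau>"
    let ?b = "?L (- a)"
    \<comment> \<open>\<open>\<theta>\<close> is only continuous and monotone, so the image of the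
      circle is deformed linearly: \<open>\<theta> (t + y)\<close> becomes
      \<open>\<theta> t + y\<close>, a translation, which gives an honest circle in the
      page.\<close>
    let ?x = "\<lambda>s \<tau>. (1 - s) * \<theta> (t + Re (?z \<tau>)) + s * (\<theta> t + Re (?z \<tau>))"
    let ?Z = "\<lambda>s \<tau>. page m (Complex (?x s \<tau>) (Im (?z \<tau>)))"
    have z: "norm (?z \<tau>) < 2 * \<rho>" "Im (?z \<tau>) < 0" for \<tau>
      using norm_less[of "?z \<tau>" "- a"] Im_neg[of "?z \<tau>"] norm_c[of \<tau>] a by simp_all
    have "of_real (\<theta> t) + - a = Complex (\<theta> (t + Re (- a))) (Im (- a))" using a by (simp add: complex_eq_iff)
    then have b: "?b = ?G (- a)" by (simp only:)
    have bWg: "?b \<in> Wg" using S(3)[of "- a"] a \<rho> by (intro in_Wg) simp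
    have "winding_number (\<lambda>\<tau>. (\<phi> \<circ> g) (?Z 0 \<tau>)) ((\<phi> \<circ> g) ((\<lambda>_. ?b) 0)) = winding_number (\<lambda>\<tau>. (\<phi> \<circ> g) (?Z 1 \<tau>)) ((\<phi> \<circ> g) ((\<lambda>_. ?b) 1))"
    proof (rule winding_number_injective_homotopy[OF Wg(2,3)])
      have "continuous_on UNIV (\<lambda>x :: real \<times> real. \<theta> (t + Re (?z (snd x))))"
        by (rule continuous_on_compose2[OF \<theta>(1)]) (auto intro!: continuous_intros)
      then have "continuous_on ({0..1} \<times> {0..1}) (\<lambda>x :: real \<times> real. \<theta> (t + Re (?z (snd x))))"
        by (rule continuous_on_subset) simp
      then show "continuous_on ({0..1} \<times> {0..1}) (\<lambda>(s, \<tau>). ?Z s \<tau>)"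
        unfolding case_prod_unfold page_def by (intro continuous_intros)
      show "?Z s \<tau> \<in> Wg" if "s \<in> {0..1}" "\<tau> \<in> {0..1}" for s \<tau>
      proof (rule in_Wg)
        have "?Z s \<tau> = (1 - s) *\<^sub>R ?G (?z \<tau>) + s *\<^sub>R ?L (?z \<tau>)"
        proof -
          have "Complex (?x s \<tau>) (Im (?z \<tau>)) = of_real (1 - s) * Complex (\<theta> (t + Re (?z \<tau>))) (Im (?z \<tau>)) + of_real s * (of_real (\<theta> t) + ?z \<tau>)"
            by (simp add: complex_eq_iff algebra_simps)
          then show ?thesis by (simp only: page_affine)
        qed
        also have "\<dots> \<in> interior model_triangle \<inter> ball q \<eta>"
          by (rule convexD[OF convex \<delta>(5)[OF S(1)[OF z(1)] z(2)] S(3)[OF z]]) (use that in auto)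
        finally show "?Z s \<tau> \<in> interior model_triangle \<inter> ball q \<eta>" .
      qed
      show "?Z s \<tau> \<noteq> ?b" if s: "s \<in> {0..1}" for s \<tau>
      proof
        assume "?Z s \<tau> = ?b"
        then have "Complex (?x s \<tau>) (Im (?z \<tau>)) = of_real (\<theta> t) + - a" by (simp only: page_inject)
        then have eq: "?x s \<tau> = \<theta> t" "Im (?z \<tau>) = - \<rho>"
          using a by (simp_all add: complex_eq_iff)
        let ?y = "Re (?z \<tau>)"
        \<comment> \<open>As \<open>\<theta>\<close> increases, the left side has the sign of
          \<open>?y\<close>. It vanishes only for \<open>?y = 0\<close>, and then the circle would
          pass through its own centre.\<close>
        have "(1 - s) * (\<theta> (t + ?y) - \<theta> t) + s * ?y = 0" using eq(1) by (simp add: algebra_simps)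
        moreover have "(1 - s) * (\<theta> (t + ?y) - \<theta> t) + s * ?y > 0" if "?y > 0"
          using strict_monoD[OF \<theta>(2), of t "t + ?y"] that s
          by (cases "s = 0") (auto intro!: add_nonneg_pos)
        moreover have "(1 - s) * (\<theta> (t + ?y) - \<theta> t) + s * ?y < 0" if "?y < 0"
          using strict_monoD[OF \<theta>(2), of "t + ?y" t] that s
          by (cases "s = 0") (auto intro!: add_nonpos_neg simp: mult_le_0_iff mult_less_0_iff)
        ultimately have "?y = 0" by fastforce
        with eq(2) a have "?c \<tau> = 0" by (simp add: complex_eq_iff)
        with norm_c[of \<tau>] \<rho> show False by simp
      qed
    qed (use bWg in simp_all)
    moreover have "winding_number (\<lambda>\<tau>. (\<phi> \<circ> g) (?b + ?d * cis (2 * pi * \<tau>))) ((\<phi> \<circ> g) ?b) = 1"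
    proof (rule preserves_orientation_circle(1)[OF po(2) Wg(2,3)])
      show "cball ?b (norm ?d) \<subseteq> Wg"
      proof
        fix w assume "w \<in> cball ?b (norm ?d)"
        then obtain z where z: "w = page m z" "dist (of_real (\<theta> t) + - a) z \<le> r" using page_cball \<rho>(2) by blast
        define y where "y = z - of_real (\<theta> t)"
        have wy: "w = ?L y" by (simp add: z y_def)
        have y: "norm (y + a) \<le> r" using z(2) by (simp add: y_def dist_norm norm_minus_commute algebra_simps)
        have y': "norm y < 2 * \<rho>" using norm_less[of y "- a"] y a by simp
        show "w \<in> Wg"
          unfolding wy by (rule in_Wg, rule S(3)[OF y' Im_neg[OF y]])
      qed
      show "?d \<noteq> 0" using model_corner_distinct[of m] \<rho> by simp
    qed
    moreover have "?Z 1 \<tau> = ?b + ?d * cis (2 * pi * \<tau>)" for \<tau>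
    proof -
      have "Complex (?x 1 \<tau>) (Im (?z \<tau>)) = of_real (\<theta> t) + - a + ?c \<tau>" by (simp add: complex_eq_iff)
      then show ?thesis by (simp only: page_circle)
    qed
    moreover have "(\<phi> \<circ> ?h) (?C 1 + ?c \<tau>) = (\<phi> \<circ> g) (?Z 0 \<tau>)" for \<tau>
      using z(2)[of \<tau>] by simp
    moreover have "(\<phi> \<circ> ?h) (?C 1) = (\<phi> \<circ> g) ?b"
      unfolding b using a \<rho> by simp
    ultimately show ?thesis by presburger
  qed
  ultimately show False by simp
qed

section \<open>Gluing around a vertex\<close>

lemma half_discs_not_boundary:
  fixes F G :: "complex \<Rightarrow> 'a"
  assumes "r > 0"
    and "continuous_map (top_of_set (ball 0 r \<inter> {z. Im z \<ge> 0})) X F" "inj_on F (ball 0 r \<inter> {z. Im z \<ge> 0})"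
    and "continuous_map (top_of_set (ball 0 r \<inter> {z. Im z \<le> 0})) X G" "inj_on G (ball 0 r \<inter> {z. Im z \<le> 0})"
    and "\<And>z. z \<in> ball 0 r \<Longrightarrow> Im z = 0 \<Longrightarrow> F z = G z"
    and "\<And>z w. z \<in> ball 0 r \<Longrightarrow> w \<in> ball 0 r \<Longrightarrow> Im z > 0 \<Longrightarrow> Im w < 0 \<Longrightarrow> F z \<noteq> G w"
  shows "F 0 \<notin> boundary X"
proof -
  let ?h = "\<lambda>z. if 0 \<le> Im z then F z else G z"
  have "?h ` ball 0 r \<inter> boundary X = {}"
    by (rule image_not_boundary[OF open_ball glue_half_discs[OF assms(2-7)]])
  moreover have "?h 0 \<in> ?h ` ball 0 r" using assms(1) by (intro imageI) simp
  moreover have "?h 0 = F 0" by simp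
  ultimately show ?thesis by (metis disjoint_iff)
qed

text \<open>Quadrant coordinates at a corner of a triangle: the origin is the vertex, and the two
  axes run along the adjacent sides, \<open>C\<close> before \<open>C'\<close> in clockwise
  order.\<close>

definition sector :: "'a topology \<Rightarrow> 'a set \<Rightarrow> real \<Rightarrow> 'a set \<Rightarrow> 'a set \<Rightarrow> 'a set \<Rightarrow> (real \<Rightarrow> real \<Rightarrow> 'a) \<Rightarrow> bool" where
  "sector X M \<delta> U C C' F \<longleftrightarrow>
     continuous_map (top_of_set ({0..<\<delta>} \<times> {0..<\<delta>})) X (\<lambda>x. F (fst x) (snd x)) \<and>
     inj_on (\<lambda>x. F (fst x) (snd x)) ({0..<\<delta>} \<times> {0..<\<delta>}) \<and> F 0 0 \<in> M \<and>
     (\<forall>u. 0 < u \<longrightarrow> u < \<delta> \<longrightarrow> F u 0 \<in> C \<and> F 0 u \<in> C') \<and>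
     (\<forall>u v. 0 < u \<longrightarrow> u < \<delta> \<longrightarrow> 0 < v \<longrightarrow> v < \<delta> \<longrightarrow> F u v \<in> U)"

lemma sector_inj:
  "sector X M \<delta> U C C' F \<Longrightarrow> F u v = F u' v' \<Longrightarrow> u \<in> {0..<\<delta>} \<Longrightarrow> v \<in> {0..<\<delta>} \<Longrightarrow> u' \<in> {0..<\<delta>} \<Longrightarrow> v' \<in> {0..<\<delta>}
    \<Longrightarrow> u = u' \<and> v = v'"
  using inj_onD[of "\<lambda>x. F (fst x) (snd x)" "{0..<\<delta>} \<times> {0..<\<delta>}" "(u, v)" "(u', v')"] by (simp add: sector_def)

lemma sector_in:
  assumes "sector X M \<delta> U C C' F"
  shows "F 0 0 \<in> M" "u \<in> {0<..<\<delta>} \<Longrightarrow> F u 0 \<in> C" "u \<in> {0<..<\<delta>} \<Longrightarrow> F 0 u \<in> C'"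
    "u \<in> {0<..<\<delta>} \<Longrightarrow> v \<in> {0<..<\<delta>} \<Longrightarrow> F u v \<in> U"
  using assms by (simp_all add: sector_def)

lemma continuous_map_sector:
  assumes "sector X M \<delta> U C C' F" "continuous_on S p" "continuous_on S q"
    "\<And>z. z \<in> S \<Longrightarrow> p z \<in> {0..<\<delta>} \<and> q z \<in> {0..<\<delta>}"
  shows "continuous_map (top_of_set S) X (\<lambda>z. F (p z) (q z))"
proof -
  have "continuous_map (top_of_set S) (top_of_set ({0..<\<delta>} \<times> {0..<\<delta>})) (\<lambda>z. (p z, q z))"
    using assms(2-4) by (intro continuous_map_into_subtopology) (auto intro!: continuous_intros)
  from continuous_map_compose[OF this, of X "\<lambda>x. F (fst x) (snd x)"] assms(1) show ?thesis
    by (simp add: sector_def o_def)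
qed

text \<open>A quadrant is opened up to a half plane by \<open>(u, v) \<mapsto> (u - v, min u v)\<close>; the following is the inverse.\<close>

lemma half_disc_of_sector:
  assumes F: "sector X M \<delta> U C C' F"
  defines "u \<equiv> \<lambda>z. max (Re z) 0 + Im z" and "v \<equiv> \<lambda>z. max (- Re z) 0 + Im z"
  shows "continuous_map (top_of_set (ball 0 (\<delta> / 2) \<inter> {z. Im z \<ge> 0})) X (\<lambda>z. F (u z) (v z))"
    and "inj_on (\<lambda>z. F (u z) (v z)) (ball 0 (\<delta> / 2) \<inter> {z. Im z \<ge> 0})"
    and "z \<in> ball 0 (\<delta> / 2) \<Longrightarrow> Im z > 0 \<Longrightarrow> F (u z) (v z) \<in> U"
proof -
  have uv: "u z \<in> {0..<\<delta>} \<and> v z \<in> {0..<\<delta>} \<and> (Im z > 0 \<longrightarrow> u z > 0 \<and> v z > 0)"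
    if "z \<in> ball 0 (\<delta> / 2)" "Im z \<ge> 0" for z
    using that abs_Re_le_cmod[of z] abs_Im_le_cmod[of z] by (auto simp: u_def v_def max_def)
  show "continuous_map (top_of_set (ball 0 (\<delta> / 2) \<inter> {z. Im z \<ge> 0})) X (\<lambda>z. F (u z) (v z))"
    by (rule continuous_map_sector[OF F]) (use uv in \<open>auto simp: u_def v_def intro!: continuous_intros\<close>)
  show "inj_on (\<lambda>z. F (u z) (v z)) (ball 0 (\<delta> / 2) \<inter> {z. Im z \<ge> 0})"
  proof (rule inj_onI)
    fix z w assume *: "z \<in> ball 0 (\<delta> / 2) \<inter> {z. Im z \<ge> 0}" "w \<in> ball 0 (\<delta> / 2) \<inter> {z. Im z \<ge> 0}"
      "F (u z) (v z) = F (u w) (v w)"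
    then have "u z = u w \<and> v z = v w" using uv by (intro sector_inj[OF F]) auto
    then show "z = w" by (auto simp: u_def v_def complex_eq_iff max_def split: if_splits)
  qed
  show "F (u z) (v z) \<in> U" if "z \<in> ball 0 (\<delta> / 2)" "Im z > 0"
    using uv[of z] that by (intro sector_in(4)[OF F]) auto
qed

text \<open>The first sector is opened up to the upper half disc, the second one is opened up and
  turned by 180 degrees. The axes then match, and the vertex becomes the centre of an embedded disc
  although it lies on the boundary.\<close>

lemma no_two_sectors:
  assumes F: "sector X M \<delta> U C C' F" and G: "sector X M \<delta> V C' C G"
    and "\<delta> > 0" and M: "M \<subseteq> boundary X" and UV: "U \<inter> V = {}"
    and eq: "\<And>u. u \<in> {0..<\<delta>} \<Longrightarrow> F u 0 = G 0 u" "\<And>u. u \<in> {0..<\<delta>} \<Longrightarrow> F 0 u = G u 0"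
  shows False
proof -
  let ?D = "ball 0 (\<delta> / 2) :: complex set"
  let ?F = "\<lambda>z. F (max (Re z) 0 + Im z) (max (- Re z) 0 + Im z)"
  let ?G0 = "\<lambda>z. G (max (Re z) 0 + Im z) (max (- Re z) 0 + Im z)"
  let ?G = "\<lambda>z. ?G0 (- z)"
  note f = half_disc_of_sector[OF F] and g = half_disc_of_sector[OF G]
  have "?F 0 \<notin> boundary X"
  proof (rule half_discs_not_boundary[OF _ f(1,2), of ?G])
    have neg: "- z \<in> ?D \<inter> {z. Im z \<ge> 0} \<longleftrightarrow> z \<in> ?D \<inter> {z. Im z \<le> 0}" for z :: complex by simp
    have "continuous_map (top_of_set (?D \<inter> {z. Im z \<le> 0})) (top_of_set (?D \<inter> {z. Im z \<ge> 0})) uminus"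
      by (intro continuous_map_into_subtopology) (use neg in \<open>auto intro!: continuous_intros\<close>)
    from continuous_map_compose[OF this g(1)]
    show "continuous_map (top_of_set (?D \<inter> {z. Im z \<le> 0})) X ?G" by (simp add: o_def)
    show "inj_on ?G (?D \<inter> {z. Im z \<le> 0})"
    proof (rule inj_onI)
      fix z w assume "z \<in> ?D \<inter> {z. Im z \<le> 0}" "w \<in> ?D \<inter> {z. Im z \<le> 0}" "?G z = ?G w"
      with inj_onD[OF g(2), of "- z" "- w"] neg show "z = w" by simp
    qed
    show "?F z \<noteq> ?G w" if "z \<in> ?D" "w \<in> ?D" "Im z > 0" "Im w < 0" for z w
      using f(3)[of z] g(3)[of "- w"] that UV by force
    show "?F z = ?G z" if "z \<in> ?D" "Im z = 0" for z
    proof -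
      have "\<bar>Re z\<bar> < \<delta>" using that abs_Re_le_cmod[of z] \<open>\<delta> > 0\<close> by simp
      then show ?thesis using eq(1)[of "Re z"] eq(2)[of "- Re z"] eq(1)[of 0] \<open>Im z = 0\<close> by (simp add: max_def)
    qed
  qed (use \<open>\<delta> > 0\<close> in simp)
  then show False using sector_in(1)[OF F] M by auto
qed

text \<open>The first sector fills the upper half disc, the second the lower left and the third the
  lower right quadrant. In \<open>disj\<close>, the first equation separates the two lower
  quadrants, where the vertex and the negative imaginary axis count for the second sector; the other
  one separates the open upper half from the open lower half.\<close>

lemma no_three_sectors:
  assumes F: "sector X M \<delta> U C1 C2 F" and G: "sector X M \<delta> V C2 C3 G" and H: "sector X M \<delta> W C3 C1 H"
    and "\<delta> > 0" and M: "M \<subseteq> boundary X"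
    and disj: "(V \<union> C2 \<union> C3 \<union> M) \<inter> (W \<union> C1) = {}" "U \<inter> (V \<union> W \<union> C3) = {}"
    and eq: "\<And>u. u \<in> {0..<\<delta>} \<Longrightarrow> F 0 u = G u 0" "\<And>u. u \<in> {0..<\<delta>} \<Longrightarrow> G 0 u = H u 0" "\<And>u. u \<in> {0..<\<delta>} \<Longrightarrow> H 0 u = F u 0"
  shows False
proof -
  let ?D = "ball 0 (\<delta> / 2) :: complex set"
  let ?F = "\<lambda>z. F (max (Re z) 0 + Im z) (max (- Re z) 0 + Im z)"
  let ?G = "\<lambda>z. if Re z \<le> 0 then G (- Re z) (- Im z) else H (- Im z) (Re z)"
  note f = half_disc_of_sector[OF F]
  have b: "\<bar>Re z\<bar> < \<delta>" "\<bar>Im z\<bar> < \<delta>" if "z \<in> ?D" for z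
    using that abs_Re_le_cmod[of z] abs_Im_le_cmod[of z] \<open>\<delta> > 0\<close> by auto
  have inG: "G (- Re z) (- Im z) \<in> V \<union> C2 \<union> C3 \<union> M" "Im z < 0 \<Longrightarrow> G (- Re z) (- Im z) \<in> V \<union> C3"
    if "z \<in> ?D" "Im z \<le> 0" "Re z \<le> 0" for z
    using sector_in(1)[OF G] sector_in(2)[OF G, of "- Re z"] sector_in(4)[OF G, of "- Re z" "- Im z"] sector_in(3)[OF G, of "- Im z"] b[OF that(1)] that
    by (cases "Re z = 0"; cases "Im z = 0"; auto)+
  have inH: "H (- Im z) (Re z) \<in> W \<union> C1" "Im z < 0 \<Longrightarrow> H (- Im z) (Re z) \<in> W"
    if "z \<in> ?D" "Im z \<le> 0" "Re z > 0" for z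
    using sector_in(3)[OF H, of "Re z"] sector_in(4)[OF H, of "- Im z" "Re z"] b[OF that(1)] that
    by (cases "Im z = 0"; auto)+
  have "?F 0 \<notin> boundary X"
  proof (rule half_discs_not_boundary[OF _ f(1,2), of ?G])
    show "continuous_map (top_of_set (?D \<inter> {z. Im z \<le> 0})) X ?G"
    proof (rule continuous_map_cases_le)
      show "continuous_map (subtopology (top_of_set (?D \<inter> {z. Im z \<le> 0})) {z \<in> topspace (top_of_set (?D \<inter> {z. Im z \<le> 0})). Re z \<le> 0}) X (\<lambda>z. G (- Re z) (- Im z))"
        unfolding subtopology_subtopology
        by (rule continuous_map_sector[OF G]) (use b in \<open>auto intro!: continuous_intros\<close>, fastforce+)
      show "continuous_map (subtopology (top_of_set (?D \<inter> {z. Im z \<le> 0})) {z \<in> topspace (top_of_set (?D \<inter> {z. Im z \<le> 0})). 0 \<le> Re z}) X (\<lambda>z. H (- Im z) (Re z))"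
        unfolding subtopology_subtopology
        by (rule continuous_map_sector[OF H]) (use b in \<open>auto intro!: continuous_intros\<close>, fastforce+)
      show "G (- Re z) (- Im z) = H (- Im z) (Re z)" if "z \<in> topspace (top_of_set (?D \<inter> {z. Im z \<le> 0}))" "Re z = 0" for z
      proof -
        from that b[of z] have "- Im z \<in> {0..<\<delta>}" by simp
        from eq(2)[OF this] that(2) show ?thesis by simp
      qed
    qed (auto intro!: continuous_intros)
    show "inj_on ?G (?D \<inter> {z. Im z \<le> 0})"
    proof (rule inj_onI)
      fix z w assume zw: "z \<in> ?D \<inter> {z. Im z \<le> 0}" "w \<in> ?D \<inter> {z. Im z \<le> 0}" and e: "?G z = ?G w"
      have d: "z \<in> ?D" "w \<in> ?D" "Im z \<le> 0" "Im w \<le> 0" using zw by auto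
      consider "Re z \<le> 0" "Re w \<le> 0" | "Re z > 0" "Re w > 0" | "Re z \<le> 0" "Re w > 0" | "Re z > 0" "Re w \<le> 0" by linarith
      then show "z = w"
      proof cases
        case 1
        have "- Re z = - Re w \<and> - Im z = - Im w"
          by (rule sector_inj[OF G]) (use 1 e d b[of z] b[of w] in auto)
        then show ?thesis by (simp add: complex_eq_iff)
      next
        case 2
        have "- Im z = - Im w \<and> Re z = Re w"
          by (rule sector_inj[OF H]) (use 2 e d b[of z] b[of w] in auto)
        then show ?thesis by (simp add: complex_eq_iff)
      next
        case 3
        with inG(1)[of z] inH(1)[of w] d e disj(1) show ?thesis by auto
      next
        case 4
        with inG(1)[of w] inH(1)[of z] d e disj(1) show ?thesis by auto
      qed
    qed
    show "?F z \<noteq> ?G w" if "z \<in> ?D" "w \<in> ?D" "Im z > 0" "Im w < 0" for z w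
    proof -
      have "?G w \<in> V \<union> W \<union> C3" using inG(2)[of w] inH(2)[of w] that by auto
      with f(3)[OF that(1,3)] disj(2) show ?thesis by (metis disjoint_iff)
    qed
    show "?F z = ?G z" if "z \<in> ?D" "Im z = 0" for z
    proof -
      have "\<bar>Re z\<bar> < \<delta>" using b(1) that by blast
      then show ?thesis using eq(1)[of "- Re z"] eq(3)[of "Re z"] eq(1)[of 0] \<open>Im z = 0\<close> by (simp add: max_def)
    qed
  qed (use \<open>\<delta> > 0\<close> in simp)
  then show False using sector_in(1)[OF F] M by auto
qed

text \<open>Only the coordinate along side \<open>n\<close> is reparametrized, by the gluing with
  the neighbouring triangle, so that consecutive sectors agree on their common edge. The bounds
  \<open>1 / 2\<close> keep \<open>\<alpha> u + v\<close> below 1.\<close>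

lemma sector_of_corner:
  assumes f: "has_side X M U C f n" and f': "has_side X M U C' f (n + 1)" and CC: "C \<inter> C' = {}"
    and \<alpha>: "continuous_on UNIV \<alpha>" "strict_mono \<alpha>" "\<alpha> 0 = (0::real)" and \<delta>: "\<alpha> \<delta> \<le> 1 / 2" "\<delta> \<le> 1 / 2"
  shows "sector X M \<delta> U C C' (\<lambda>u v. f (corner_sector n (\<alpha> u) v))"
proof -
  have pos: "0 < \<alpha> u" if "0 < u" for u using strict_monoD[OF \<alpha>(2), of 0 u] \<alpha>(3) that by simp
  have nonneg: "0 \<le> \<alpha> u" if "0 \<le> u" for u using pos[of u] \<alpha>(3) that by (cases "u = 0") auto
  have less: "\<alpha> u < 1 / 2" if "u < \<delta>" for u using strict_monoD[OF \<alpha>(2) that] \<delta> by simp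
  let ?x = "\<lambda>u v. corner_sector n (\<alpha> u) v"
  have x: "?x u v \<in> model_triangle" if "0 \<le> u" "u < \<delta>" "0 \<le> v" "v < \<delta>" for u v
    using nonneg[of u] less[of u] that \<delta> by (intro corner_sector_in_triangle(1)) auto
  have "continuous_map (top_of_set ({0..<\<delta>} \<times> {0..<\<delta>})) X (\<lambda>x. f (?x (fst x) (snd x)))"
  proof (rule continuous_map_page[OF f])
    have "continuous_on ({0..<\<delta>} \<times> {0..<\<delta>}) (\<lambda>x :: real \<times> real. \<alpha> (fst x))"
      by (rule continuous_on_compose2[OF \<alpha>(1)]) (auto intro!: continuous_intros)
    then show "continuous_on ({0..<\<delta>} \<times> {0..<\<delta>}) (\<lambda>x. ?x (fst x) (snd x))"
      unfolding corner_sector_def by (intro continuous_intros)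
  qed (use x in auto)
  moreover have i: "?x u v \<in> interior model_triangle" if "0 < u" "u < \<delta>" "0 < v" "v < \<delta>" for u v
    using pos[of u] less[of u] that \<delta> by (intro corner_sector_in_triangle(2)) auto
  moreover have s: "?x u 0 \<in> model_side n" if "0 < u" "u < \<delta>" for u
    unfolding corner_sector_sides model_side_eq by (rule imageI) (use pos[of u] less[of u] that in auto)
  moreover have s': "?x 0 v \<in> model_side (n + 1)" if "0 < v" "v < \<delta>" for v
    unfolding \<alpha>(3) corner_sector_sides model_side_eq using that \<delta> by auto
  moreover have "?x 0 0 = model_corner (n + 1)" by (simp add: \<alpha>(3) corner_sector_def)
  moreover have "f ` interior model_triangle = U" "f ` model_side n = C" "f ` model_side (n + 1) = C'" "f (model_corner (n + 1)) \<in> M"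
    and inj: "inj_on f (interior model_triangle)" "inj_on f (model_side n)" "inj_on f (model_side (n + 1))"
    and disj: "U \<inter> C = {}" "U \<inter> C' = {}" "U \<inter> M = {}" "C \<inter> M = {}" "C' \<inter> M = {}"
    using f f' by (simp_all add: has_side_def)
  ultimately have cont: "continuous_map (top_of_set ({0..<\<delta>} \<times> {0..<\<delta>})) X (\<lambda>x. f (?x (fst x) (snd x)))"
    and M: "f (?x 0 0) \<in> M" and C: "\<And>u. 0 < u \<Longrightarrow> u < \<delta> \<Longrightarrow> f (?x u 0) \<in> C" and C': "\<And>u. 0 < u \<Longrightarrow> u < \<delta> \<Longrightarrow> f (?x 0 u) \<in> C'"
    and U: "\<And>u v. 0 < u \<Longrightarrow> u < \<delta> \<Longrightarrow> 0 < v \<Longrightarrow> v < \<delta> \<Longrightarrow> f (?x u v) \<in> U"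
    by auto
  have uv: "u = u' \<and> v = v'"
    if b: "0 \<le> u" "u < \<delta>" "0 \<le> v" "v < \<delta>" "0 \<le> u'" "u' < \<delta>" "0 \<le> v'" "v' < \<delta>" and eq: "f (?x u v) = f (?x u' v')"
    for u v u' v'
  proof -
    \<comment> \<open>The four pieces of the surface are pairwise disjoint, so the image of a point
      tells which of its coordinates vanish; injectivity on the single pieces does the rest.\<close>
    define loc where "loc u v = (if u = 0 then (if v = 0 then M else C') else (if v = 0 then C else U))" for u v :: real
    have loc: "f (?x u v) \<in> loc u v" if "0 \<le> u" "u < \<delta>" "0 \<le> v" "v < \<delta>" for u v
      using that M C[of u] C'[of v] U[of u v] by (auto simp: loc_def)
    have "loc u v \<inter> loc u' v' \<noteq> {}" using loc[of u v] loc[of u' v'] b eq by auto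
    then have z: "u = 0 \<longleftrightarrow> u' = 0" "v = 0 \<longleftrightarrow> v' = 0"
      by (cases "u = 0"; cases "v = 0"; cases "u' = 0"; cases "v' = 0"; use disj CC in \<open>simp add: loc_def Int_commute\<close>)+
    have "?x u v = ?x u' v'"
    proof (cases "u = 0"; cases "v = 0")
      assume "u = 0" "v = 0" then show ?thesis using z by simp
    next
      assume "u = 0" "v \<noteq> 0"
      then show ?thesis using z b eq s'[of v] s'[of v'] by (intro inj_onD[OF inj(3)]) auto
    next
      assume "u \<noteq> 0" "v = 0"
      then show ?thesis using z b eq s[of u] s[of u'] by (intro inj_onD[OF inj(2)]) auto
    next
      assume "u \<noteq> 0" "v \<noteq> 0"
      then show ?thesis using z b eq i[of u v] i[of u' v'] by (intro inj_onD[OF inj(1)]) auto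
    qed
    then show ?thesis
      using strict_mono_eq[OF \<alpha>(2)] by (simp add: corner_sector_inject)
  qed
  have "inj_on (\<lambda>x. f (?x (fst x) (snd x))) ({0..<\<delta>} \<times> {0..<\<delta>})"
  proof (rule inj_onI)
    fix x y :: "real \<times> real"
    assume "x \<in> {0..<\<delta>} \<times> {0..<\<delta>}" "y \<in> {0..<\<delta>} \<times> {0..<\<delta>}"
      and eq: "f (?x (fst x) (snd x)) = f (?x (fst y) (snd y))"
    then show "x = y" using uv[OF _ _ _ _ _ _ _ _ eq] by (simp add: prod_eq_iff mem_Times_iff)
  qed
  with cont M C C' U show ?thesis by (simp add: sector_def)
qed

text \<open>Of the two possible directions, orientation excludes the parallel one. The form
  \<open>1 - \<tau> t\<close> says that the start of one side meets the end of the other.\<close>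

lemma side_gluing:
  assumes X: "Hausdorff_space X" "oriented_atlas X A"
    and f: "has_side X M U C f n" and g: "has_side X M V C g m" and UV: "U \<inter> V = {}"
    and of: "orientation_preserving_triangle A f" "orientation_preserving_triangle A g"
  obtains \<tau> where "continuous_on UNIV \<tau>" "strict_mono \<tau>" "\<tau> 0 = (0::real)"
    "\<And>t. t \<in> {0..1} \<Longrightarrow> f (page n (of_real t)) = g (page m (of_real (1 - \<tau> t)))"
proof -
  from side_reparametrization[OF X(1) f g] obtain \<tau> where
    \<tau>: "continuous_on UNIV \<tau>" "strict_mono \<tau>" "\<tau> 0 = (0::real)" "\<tau> 1 = (1::real)"
    "(\<forall>t \<in> {0..1}. f (page n (of_real t)) = g (page m (of_real (\<tau> t)))) \<or>
     (\<forall>t \<in> {0..1}. f (page n (of_real t)) = g (page m (of_real (1 - \<tau> t))))" by blast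
  have r: "\<tau> t \<in> {0<..<1}" if "t \<in> {0<..<1}" for t
    using strict_monoD[OF \<tau>(2), of 0 t] strict_monoD[OF \<tau>(2), of t 1] \<tau>(3,4) that by auto
  have "\<not> (\<forall>t \<in> {0..1}. f (page n (of_real t)) = g (page m (of_real (\<tau> t))))"
  proof
    assume *: "\<forall>t \<in> {0..1}. f (page n (of_real t)) = g (page m (of_real (\<tau> t)))"
    show False
      by (rule gluing_reverses_orientation[OF X(2) f g UV of \<tau>(1,2) r]) (use * in auto)
  qed
  with \<tau>(5) that[OF \<tau>(1-3)] show ?thesis by blast
qed

lemma small_bound:
  assumes "continuous_on UNIV \<tau>" "strict_mono \<tau>" "\<tau> 0 = (0::real)"
  obtains \<delta> :: real where "\<delta> > 0" "\<And>u. u \<le> \<delta> \<Longrightarrow> \<tau> u \<le> 1 / 2"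
proof -
  have "open {u. \<tau> u < 1 / 2}" by (intro open_Collect_less continuous_intros assms(1))
  moreover have "0 \<in> {u. \<tau> u < 1 / 2}" using assms(3) by simp
  ultimately obtain \<delta> where \<delta>: "\<delta> > 0" "cball 0 \<delta> \<subseteq> {u. \<tau> u < 1 / 2}" using open_contains_cball by blast
  then have "\<delta> \<in> {u. \<tau> u < 1 / 2}" by (intro subsetD[OF \<delta>(2)]) simp
  then have "\<tau> u \<le> 1 / 2" if "u \<le> \<delta>" for u
    using monoD[OF strict_mono_mono[OF assms(2)] that] by simp
  with \<delta>(1) that show ?thesis by blast
qed

text \<open>Each sector takes its reparametrization from the gluing with the second side of the
  preceding sector, cyclically around the vertex; \<open>\<delta>\<close> is small enough for
  both.\<close>

lemma no_corner_2cycle_in_surface: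
  assumes X: "Hausdorff_space X" "oriented_atlas X A" and M: "M \<subseteq> boundary X"
    and f: "has_side X M U C f n" "has_side X M U C' f (n + 1)" "orientation_preserving_triangle A f"
    and g: "has_side X M V C' g m" "has_side X M V C g (m + 1)" "orientation_preserving_triangle A g"
    and UV: "U \<inter> V = {}" and CC: "C \<inter> C' = {}"
  shows False
proof -
  have VU: "V \<inter> U = {}" "C' \<inter> C = {}" using UV CC by auto
  obtain \<alpha> where \<alpha>: "continuous_on UNIV \<alpha>" "strict_mono \<alpha>" "\<alpha> 0 = (0::real)"
    "\<And>t. t \<in> {0..1} \<Longrightarrow> g (page (m + 1) (of_real t)) = f (page n (of_real (1 - \<alpha> t)))"
    using side_gluing[OF X g(2) f(1) VU(1) g(3) f(3)] by blast
  obtain \<beta> where \<beta>: "continuous_on UNIV \<beta>" "strict_mono \<beta>" "\<beta> 0 = (0::real)"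
    "\<And>t. t \<in> {0..1} \<Longrightarrow> f (page (n + 1) (of_real t)) = g (page m (of_real (1 - \<beta> t)))"
    using side_gluing[OF X f(2) g(1) UV f(3) g(3)] by blast
  obtain d1 where d1: "d1 > 0" "\<And>u. u \<le> d1 \<Longrightarrow> \<alpha> u \<le> 1 / 2" using small_bound[OF \<alpha>(1-3)] by blast
  obtain d2 where d2: "d2 > 0" "\<And>u. u \<le> d2 \<Longrightarrow> \<beta> u \<le> 1 / 2" using small_bound[OF \<beta>(1-3)] by blast
  define \<delta> where "\<delta> = min (min d1 d2) (1 / 2)"
  have \<delta>: "\<delta> > 0" "\<alpha> \<delta> \<le> 1 / 2" "\<beta> \<delta> \<le> 1 / 2" "\<delta> \<le> 1 / 2" using d1 d2 by (auto simp: \<delta>_def)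
  show False
    by (rule no_two_sectors[OF sector_of_corner[OF f(1,2) CC \<alpha>(1-3) \<delta>(2,4)] sector_of_corner[OF g(1,2) VU(2) \<beta>(1-3) \<delta>(3,4)] \<delta>(1) M UV])
      (use \<delta>(4) \<alpha>(3,4) \<beta>(3,4) in \<open>simp_all add: corner_sector_sides\<close>)
qed

lemma no_corner_3cycle_in_surface:
  assumes X: "Hausdorff_space X" "oriented_atlas X A" and M: "M \<subseteq> boundary X"
    and f: "has_side X M U C1 f n" "has_side X M U C2 f (n + 1)" "orientation_preserving_triangle A f"
    and g: "has_side X M V C2 g m" "has_side X M V C3 g (m + 1)" "orientation_preserving_triangle A g"
    and e: "has_side X M W C3 e l" "has_side X M W C1 e (l + 1)" "orientation_preserving_triangle A e"
    and UVW: "U \<inter> V = {}" "V \<inter> W = {}" "W \<inter> U = {}"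
    and C: "C1 \<inter> C2 = {}" "C2 \<inter> C3 = {}" "C3 \<inter> C1 = {}"
    and UC: "V \<inter> C1 = {}" "U \<inter> C3 = {}" "W \<inter> C2 = {}"
  shows False
proof -
  obtain \<alpha> where \<alpha>: "continuous_on UNIV \<alpha>" "strict_mono \<alpha>" "\<alpha> 0 = (0::real)"
    "\<And>t. t \<in> {0..1} \<Longrightarrow> e (page (l + 1) (of_real t)) = f (page n (of_real (1 - \<alpha> t)))"
    using side_gluing[OF X e(2) f(1) UVW(3) e(3) f(3)] by blast
  obtain \<beta> where \<beta>: "continuous_on UNIV \<beta>" "strict_mono \<beta>" "\<beta> 0 = (0::real)"
    "\<And>t. t \<in> {0..1} \<Longrightarrow> f (page (n + 1) (of_real t)) = g (page m (of_real (1 - \<beta> t)))"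
    using side_gluing[OF X f(2) g(1) UVW(1) f(3) g(3)] by blast
  obtain \<gamma> where \<gamma>: "continuous_on UNIV \<gamma>" "strict_mono \<gamma>" "\<gamma> 0 = (0::real)"
    "\<And>t. t \<in> {0..1} \<Longrightarrow> g (page (m + 1) (of_real t)) = e (page l (of_real (1 - \<gamma> t)))"
    using side_gluing[OF X g(2) e(1) UVW(2) g(3) e(3)] by blast
  obtain d1 where d1: "d1 > 0" "\<And>u. u \<le> d1 \<Longrightarrow> \<alpha> u \<le> 1 / 2" using small_bound[OF \<alpha>(1-3)] by blast
  obtain d2 where d2: "d2 > 0" "\<And>u. u \<le> d2 \<Longrightarrow> \<beta> u \<le> 1 / 2" using small_bound[OF \<beta>(1-3)] by blast
  obtain d3 where d3: "d3 > 0" "\<And>u. u \<le> d3 \<Longrightarrow> \<gamma> u \<le> 1 / 2" using small_bound[OF \<gamma>(1-3)] by blast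
  define \<delta> where "\<delta> = min (min d1 (min d2 d3)) (1 / 2)"
  have \<delta>: "\<delta> > 0" "\<alpha> \<delta> \<le> 1 / 2" "\<beta> \<delta> \<le> 1 / 2" "\<gamma> \<delta> \<le> 1 / 2" "\<delta> \<le> 1 / 2"
    using d1 d2 d3 by (auto simp: \<delta>_def)
  have "M \<inter> W = {}" "M \<inter> C1 = {}" "W \<inter> C3 = {}" using f(1) e(1) by (simp_all add: has_side_def Int_commute)
  with UVW C UC have "(V \<union> C2 \<union> C3 \<union> M) \<inter> (W \<union> C1) = {}" "U \<inter> (V \<union> W \<union> C3) = {}"
    by (simp_all add: Int_Un_distrib Int_Un_distrib2 Int_commute)
  then show False
    by (rule no_three_sectors[OF sector_of_corner[OF f(1,2) C(1) \<alpha>(1-3) \<delta>(2,5)]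
        sector_of_corner[OF g(1,2) C(2) \<beta>(1-3) \<delta>(3,5)] sector_of_corner[OF e(1,2) C(3) \<gamma>(1-3) \<delta>(4,5)] \<delta>(1) M])
      (use \<delta>(5) \<alpha>(3,4) \<beta>(3,4) \<gamma>(3,4) in \<open>simp_all add: corner_sector_sides\<close>)
qed

section \<open>Triangulations\<close>

lemma model_corner_mod: "model_corner (n mod 3) = model_corner n"
proof (induction n rule: less_induct)
  case (less n)
  show ?case
  proof (cases "n < 3")
    case False
    then obtain i where "n = i + 3" by (metis le_add_diff_inverse2 not_less)
    with less[of i] show ?thesis by (simp add: model_corner_periodic)
  qed simp
qed

lemma model_side_mod: "model_side (n mod 3) = model_side n"
  unfolding model_side_def by (metis mod_add_left_eq model_corner_mod)

text \<open>\<open>triangle_map\<close> speaks of the sides 0, 1, 2, so indices are reduced modulo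
  3. The disjointness holds because regions avoid the boundary, which contains \<open>M\<close>, and
  all arcs, while arcs avoid \<open>M\<close>.\<close>

lemma triangulation_has_side:
  assumes M: "M \<subseteq> boundary X" and T: "triangulation_with_reps X M T rep"
    and U: "U \<in> regions X T rep" and f: "triangle_map X M T rep U f"
    and a: "a \<in> T" "f ` model_side n = curve_interior (rep a)"
  shows "has_side X M U (curve_interior (rep a)) f n"
proof -
  have n: "n mod 3 \<in> {0, 1, 2}" for n :: nat unfolding less_3_iff by simp
  have c: "f (model_corner n) \<in> M" for n
    using f n[of n] model_corner_mod[of n] unfolding triangle_map_def by metis
  have s: "inj_on f (model_side n)"
    using f n[of n] model_side_mod[of n] unfolding triangle_map_def by metis
  have h: "homeomorphic_map (top_of_set (interior model_triangle)) (subtopology X U) f"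
    and cont: "continuous_map (top_of_set model_triangle) X f"
    using f by (simp_all add: triangle_map_def)
  have sub: "U \<subseteq> topspace X - boundary X - (\<Union>a \<in> T. curve_interior (rep a))"
    using connected_components_of_subset[of U] U unfolding regions_def by fastforce
  have "rep a \<in> a" "a \<in> arcs X M" using T a(1) by (auto simp: triangulation_with_reps_def)
  then have "arc_curve X M (rep a)" by (auto simp: arcs_def)
  then have "curve_interior (rep a) \<inter> M = {}" by (simp add: arc_curve_def simple_curve_def)
  moreover have "inj_on f (interior model_triangle)"
    using homeomorphic_imp_injective_map[OF h] by simp
  moreover have "f ` interior model_triangle = U"
  proof -
    have "topspace (subtopology X U) = U" using sub by auto
    with homeomorphic_imp_surjective_map[OF h] show ?thesis by simp
  qed
  ultimately show ?thesis
    unfolding has_side_def using cont c s a sub M by auto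
qed

lemma curve_interior_nonempty: "curve_interior \<gamma> \<noteq> {}"
  by (simp add: curve_interior_def)

theorem proposition3p1:
  fixes X :: "'a topology"
    and A :: "('a set \<times> ('a \<Rightarrow> complex)) set"
    and M :: "'a set"
    and T :: "(real \<Rightarrow> 'a) set set"
    and Q :: "(real \<Rightarrow> 'a) set quiver"
    and k :: "(real \<Rightarrow> 'a) set"
  assumes "marked_bordered_surface X A M"
    and "quiver_of_triangulation X A M T Q"
    and "k \<in> verts Q"
  shows "in_degree Q k = 1 \<and> out_degree Q k = 1 \<longleftrightarrow> num_arrows Q \<noteq> num_arrows (mutation k Q)"
proof -
  from assms(1) have X: "surface X" "oriented_atlas X A" and M: "M \<subseteq> boundary X"
    by (simp_all add: marked_bordered_surface_def)
  then have H: "Hausdorff_space X" by (simp add: surface_def)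
  from assms(2) obtain rep tri where T: "triangulation_with_reps X M T rep"
    and tri: "\<And>U. U \<in> regions X T rep \<Longrightarrow> triangle_map X M T rep U (tri U) \<and> orientation_preserving_triangle A (tri U)"
    and Q: "arrows Q = cancel_2cycles (triangle_arrows X T rep tri)"
    unfolding quiver_of_triangulation_def by force
  let ?R = "regions X T rep"
  let ?C = "\<lambda>a. curve_interior (rep a)"
  define P where "P U n a \<longleftrightarrow> U \<in> ?R \<and> a \<in> T \<and> tri U ` model_side n = ?C a" for U n a
  \<comment> \<open>The choice is unambiguous: interiors of distinct arcs are disjoint and
    non-empty, so at most one arc can be the image of a side.\<close>
  define L where "L U n = (if \<exists>a. P U n a then Some (SOME a. P U n a) else None)" for U n
  have disjT: "?C a \<inter> ?C b = {}" if "a \<in> T" "b \<in> T" "a \<noteq> b" for a b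
    using T that by (auto simp: triangulation_with_reps_def)
  have unique: "a = b" if "P U n a" "P U n b" for U n a b
    using that disjT[of a b] curve_interior_nonempty[of "rep a"] by (auto simp: P_def)
  have L: "L U n = Some a \<longleftrightarrow> P U n a" for U n a
    unfolding L_def using unique someI[of "P U n" a] by (auto intro: someI)
  have side: "has_side X M U (?C a) (tri U) n" "orientation_preserving_triangle A (tri U)" "a \<in> T" "U \<in> ?R"
    if "L U n = Some a" for U n a
    using that triangulation_has_side[OF M T, of U "tri U" a n] tri[of U] by (auto simp: L P_def)
  have disjR: "U \<inter> V = {}" if "U \<in> ?R" "V \<in> ?R" "U \<noteq> V" for U V
    using that connected_components_of_overlap unfolding regions_def by metis
  have disjRT: "U \<inter> ?C a = {}" if "U \<in> ?R" "a \<in> T" for U a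
    using that connected_components_of_subset[of U] unfolding regions_def by fastforce
  have arrows: "triangle_arrows X T rep tri = corner_arrows L"
    unfolding triangle_arrows_def corner_arrows_def L P_def
    by (rule arg_cong[of _ _ "\<lambda>S. image_mset _ (mset_set S)"]) auto
  show ?thesis
  proof (cases "in_degree Q k = 1 \<and> out_degree Q k = 1")
    case True
    then show ?thesis using num_arrows_mutation_neq[of Q k] by (simp add: Q no_2cycles_cancel_2cycles)
  next
    case False
    have "num_arrows (mutation k Q) = num_arrows Q"
    \<comment> \<open>The labelling locale needs finitely many corners for its
      cardinalities.\<close>
    proof (cases "finite {(U, n, a, b). n \<in> {0, 1, 2} \<and> L U n = Some a \<and> L U (n + 1) = Some b}")
      case True
      interpret triangle_labelling L
      proof
        show "L U (n + 3) = L U n" for U n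
        proof -
          have "model_side (n + 3) = model_side n"
            using model_side_mod[of n] model_side_mod[of "n + 3"] by simp
          then have "P U (n + 3) = P U n" unfolding P_def by metis
          then show ?thesis unfolding L_def by (simp only:)
        qed
        show "(U, n) = (V, m) \<or> (U, n) = (W, l) \<or> (V, m) = (W, l)"
          if "L U n = Some a" "L V m = Some a" "L W l = Some a" "n < 3" "m < 3" "l < 3" for U n a V m W l
        proof (rule ccontr)
          assume ne: "\<not> ?thesis"
          \<comment> \<open>Different sides belong either to disjoint regions or to one triangle,
            where open sides are disjoint.\<close>
          have *: "U \<inter> V = {} \<or> tri U = tri V \<and> model_side n \<inter> model_side m = {}"
            if "L U n = Some a" "L V m = Some a" "n < 3" "m < 3" "(U, n) \<noteq> (V, m)" for U n V m
            using that disjR[of U V] side(4)[of U n a] side(4)[of V m a] model_sides_disjoint[of n m] by auto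
          show False
            by (rule no_three_sides[OF X(1) side(1)[OF that(1)] side(1)[OF that(2)] side(1)[OF that(3)]]; rule *)
              (use that ne in auto)
        qed
        show False if "U \<noteq> V" "a \<noteq> b" "L U n = Some a" "L U (n + 1) = Some b" "L V m = Some b" "L V (m + 1) = Some a"
          for U V a b n m
          by (rule no_corner_2cycle_in_surface[OF H X(2) M side(1)[OF that(3)] side(1)[OF that(4)] side(2)[OF that(3)]
              side(1)[OF that(5)] side(1)[OF that(6)] side(2)[OF that(5)]])
            (rule disjR[OF side(4)[OF that(3)] side(4)[OF that(5)] that(1)]
              disjT[OF side(3)[OF that(3)] side(3)[OF that(5)] that(2)])+
        show False if "distinct [U, V, W]" "distinct [a, b, c]" "L U n = Some a" "L U (n + 1) = Some b"
          "L V m = Some b" "L V (m + 1) = Some c" "L W l = Some c" "L W (l + 1) = Some a"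
          for U V W a b c n m l
        proof -
          from that(1,2) have ne: "U \<noteq> V" "V \<noteq> W" "W \<noteq> U" "a \<noteq> b" "b \<noteq> c" "c \<noteq> a" by auto
          note R = side(4)[OF that(3)] side(4)[OF that(5)] side(4)[OF that(7)]
          note T = side(3)[OF that(3)] side(3)[OF that(5)] side(3)[OF that(7)]
          show False
            by (rule no_corner_3cycle_in_surface[OF H X(2) M
                  side(1)[OF that(3)] side(1)[OF that(4)] side(2)[OF that(3)]
                  side(1)[OF that(5)] side(1)[OF that(6)] side(2)[OF that(5)]
                  side(1)[OF that(7)] side(1)[OF that(8)] side(2)[OF that(7)]
                  disjR[OF R(1,2) ne(1)] disjR[OF R(2,3) ne(2)] disjR[OF R(3,1) ne(3)]
                  disjT[OF T(1,2) ne(4)] disjT[OF T(2,3) ne(5)] disjT[OF T(3,1) ne(6)]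
                  disjRT[OF R(2) T(1)] disjRT[OF R(1) T(3)] disjRT[OF R(3) T(2)]])
        qed
      qed (rule True)
      show ?thesis by (rule num_arrows_mutation_eq[OF Q[unfolded arrows] False])
    next
      case infinite: False
      \<comment> \<open>\<open>mset_set\<close> of an infinite set is empty, so there are no arrows.\<close>
      then have "arrows Q = {#}" by (simp add: Q arrows corner_arrows_def cancel_2cycles_def)
      then show ?thesis
        by (simp add: num_arrows_def mutation_def composite_arrows_def reverse_at_def cancel_2cycles_def)
    qed
    with False show ?thesis by simp
  qed
qed

end
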